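(* Let $b$ be a connected locally finite weighted graph over an at most countable set $V$ with values in an ordered field $\mathbb K$, let $\pi=\pi_V^b$ be the associated real transition matrix (with $U=V$), and let $C\subseteq V$ be an essential component (with respect to $V$). (a) $C$ is recurrent if and only if $G(a)=\infty$ for some $a\in C$, equivalently for all $a\in C$. (b) $C$ is transient if and only if $G(a)<\infty$ for some $a\in C$, equivalently for all $a\in C$.
   Context: Let $(\mathbb K,\succ)$ be an ordered field and $\mathbb K^+=\{k\succ 0\}$; $\mathbb Q^+$ are the positive rationals. For $k_1,k_2\in\mathbb K^+$ write $k_1\simeq k_2$ if $c_1\prec k_1/k_2\prec c_2$ for some $c_1,c_2\in\mathbb Q^+$. Weighted graph: a symmetric map $b:V\times V\to\mathbb K^+\cup\{0\}$ with $b(x,x)=0$; $x\sim y$ means $b(x,y)\succ 0$. A path is a finite sequence $x_0\sim x_1\sim\dots\sim x_n$ ($n=0$ allowed). Connected: any two vertices are joined by a path. Locally finite: every vertex has finitely many neighbors. A subset is connected if the restriction of $b$ to it is connected. Put $b(x)=\sum_{y\in V}b(x,y)$ and $p(x,y)=b(x,y)/b(x)$ ($b(x)\succ0$ is automatic when $V$ has at least two elements). Real part: for $k\in\mathbb K$ with $|k|\prec c$ for some $c\in\mathbb Q^+$, $\rho(k)$ is the unique real number such that $|k-\rho(k)|$ is smaller than every positive rational in an ordered field containing $\mathbb K$ and $\mathbb R$; equivalently $\rho(k)=\sup_{\mathbb R}\{q\in\mathbb Q: q\preceq k\}$. $\pi_V^b(x,y)=\rho(p(x,y))$ for $x,y\in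 V$; this is a real transition matrix. A vertex $x$ is recurrent if the Markov chain $(X_n)$ with transition matrix $\pi_V^b$ started at $x$ satisfies $\mathbb P[X_n=x\text{ for infinitely many }n]=1$, and transient otherwise. A component is called recurrent (transient) if its vertices are recurrent (transient); all vertices of a component have the same type. A strongly connected component (with respect to $V$) is a maximal subset $C\subseteq V$ such that for any $x,y\in C$ there is a path $x=x_0\sim\dots\sim x_n=y$ in $V$ with $b(x)\simeq b(x_i,x_{i+1})\simeq b(y)$ for all $i=0,\dots,n-1$. It is essential if for every $x\in C$ and every path $x=x_0\sim\dots\sim x_n=y$ in $V$ with $b(x_i,x_{i+1})\simeq b(x_i)$ for all $i=0,\dots,n-1$ one has $b(x)\simeq b(y)$. Capacity: $\Delta f(x)=\frac1{b(x)}\sum_{y}b(x,y)(f(x)-f(y))$ for $f:V\to\mathbb K$. For finite connected $K\subseteq V$ and $a\in K$ there is a unique $v:V\to\mathbb K$ with $\Delta v=0$ on $K\setminus\{a\}$, $v(a)=1$, $v=0$ on $V\setminus K$; it satisfies $0\preceq v\preceq 1$. Put $\operatorname{cap}_K(a)=b(a)\Delta v(a)$. Then $0\preceq\operatorname{cap}_K(a)/b(a)\preceq1$, and $G_K(a)=1/\rho\big(\operatorname{cap}_K(a)/b(a)\big)\in[1,\infty]$ with $1/0=\infty$. For an exhaustion $(K_n)$ of $V$ (increasing sequence of finite connected sets with union $V$) with $a\in K_0$, $G(a)=\limsup_{n\to\infty}G_{K_n}(a)\in[1,\infty]$ (the sequence is monotone increasing, so this is a limit). *)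

theory Defs
  imports "HOL-Probability.Probability"
begin

text \<open>The relation \<open>k\<^sub>1 \<simeq> k\<^sub>2\<close> is only meant for positive elements, so positivity is part of the
  definition.\<close>

definition similar :: "'k::linordered_field \<Rightarrow> 'k \<Rightarrow> bool" where
  "similar k1 k2 \<longleftrightarrow> 0 < k1 \<and> 0 < k2 \<and>
     (\<exists>c1 c2 :: rat. 0 < c1 \<and> 0 < c2 \<and> of_rat c1 < k1 / k2 \<and> k1 / k2 < of_rat c2)"

text \<open>The real part of \<open>k\<close>; meaningful only if \<open>\<bar>k\<bar>\<close> is smaller than some positive rational.\<close>

definition real_part :: "'k::linordered_field \<Rightarrow> real" where
  "real_part k = Sup {real_of_rat q | q. of_rat q \<le> k}"

text \<open>The vertex set is the whole type \<open>'v\<close>.\<close>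

definition weighted_graph :: "('v \<Rightarrow> 'v \<Rightarrow> 'k::linordered_field) \<Rightarrow> bool" where
  "weighted_graph b \<longleftrightarrow>
     (\<forall>x y. b x y = b y x) \<and> (\<forall>x y. 0 \<le> b x y) \<and> (\<forall>x. b x x = 0)"

definition adj :: "('v \<Rightarrow> 'v \<Rightarrow> 'k::linordered_field) \<Rightarrow> 'v \<Rightarrow> 'v \<Rightarrow> bool" where
  "adj b x y \<longleftrightarrow> 0 < b x y"

definition nbrs :: "('v \<Rightarrow> 'v \<Rightarrow> 'k::linordered_field) \<Rightarrow> 'v \<Rightarrow> 'v set" where
  "nbrs b x = {y. adj b x y}"

definition locally_finite :: "('v \<Rightarrow> 'v \<Rightarrow> 'k::linordered_field) \<Rightarrow> bool" where
  "locally_finite b \<longleftrightarrow> (\<forall>x. finite (nbrs b x))"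

text \<open>\<open>walk b x xs y\<close>: the list \<open>xs = [x\<^sub>0, \<dots>, x\<^sub>n]\<close> is a path from \<open>x = x\<^sub>0\<close> to \<open>y = x\<^sub>n\<close>
  (\<open>n = 0\<close> allowed).\<close>

definition walk :: "('v \<Rightarrow> 'v \<Rightarrow> 'k::linordered_field) \<Rightarrow> 'v \<Rightarrow> 'v list \<Rightarrow> 'v \<Rightarrow> bool" where
  "walk b x xs y \<longleftrightarrow> xs \<noteq> [] \<and> hd xs = x \<and> last xs = y \<and>
     (\<forall>i. Suc i < length xs \<longrightarrow> adj b (xs ! i) (xs ! Suc i))"

definition connected_on :: "('v \<Rightarrow> 'v \<Rightarrow> 'k::linordered_field) \<Rightarrow> 'v set \<Rightarrow> bool" where
  "connected_on b A \<longleftrightarrow> (\<forall>x\<in>A. \<forall>y\<in>A. \<exists>xs. walk b x xs y \<and> set xs \<subseteq> A)"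

text \<open>All sums over the vertex set are sums over neighbours, the other summands being zero.\<close>

definition deg :: "('v \<Rightarrow> 'v \<Rightarrow> 'k::linordered_field) \<Rightarrow> 'v \<Rightarrow> 'k" where
  "deg b x = (\<Sum>y\<in>nbrs b x. b x y)"

definition real_transition :: "('v \<Rightarrow> 'v \<Rightarrow> 'k::linordered_field) \<Rightarrow> 'v \<Rightarrow> 'v \<Rightarrow> real" where
  "real_transition b x y = real_part (b x y / deg b x)"

definition strongly_linked :: "('v \<Rightarrow> 'v \<Rightarrow> 'k::linordered_field) \<Rightarrow> 'v set \<Rightarrow> bool" where
  "strongly_linked b C \<longleftrightarrow> (\<forall>x\<in>C. \<forall>y\<in>C. \<exists>xs. walk b x xs y \<and>
     (\<forall>i. Suc i < length xs \<longrightarrow>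
        similar (deg b x) (b (xs ! i) (xs ! Suc i)) \<and>
        similar (b (xs ! i) (xs ! Suc i)) (deg b y)))"

definition strong_component :: "('v \<Rightarrow> 'v \<Rightarrow> 'k::linordered_field) \<Rightarrow> 'v set \<Rightarrow> bool" where
  "strong_component b C \<longleftrightarrow> strongly_linked b C \<and>
     (\<forall>D. C \<subseteq> D \<longrightarrow> strongly_linked b D \<longrightarrow> D = C)"

text \<open>A graph with a single vertex \<open>x\<close> has \<open>deg b x = 0\<close> and hence no essential component: the path
  of length zero would require \<open>similar 0 0\<close>. This excludes the one case where the transition
  probabilities are undefined.\<close>

definition essential_component :: "('v \<Rightarrow> 'v \<Rightarrow> 'k::linordered_field) \<Rightarrow> 'v set \<Rightarrow> bool" where
  "essential_component b C \<longleftrightarrow> strong_component b C \<and>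
     (\<forall>x\<in>C. \<forall>y xs. walk b x xs y \<longrightarrow>
        (\<forall>i. Suc i < length xs \<longrightarrow> similar (b (xs ! i) (xs ! Suc i)) (deg b (xs ! i))) \<longrightarrow>
        similar (deg b x) (deg b y))"

text \<open>\<open>M\<close> is the law on path space of the Markov chain with transition matrix \<open>P\<close> started at \<open>x\<close>:
  \<open>X\<^sub>n\<close> is the \<open>n\<close>-th coordinate \<open>\<omega> !! n\<close>, and the probability of \<open>X\<^sub>0 = x\<^sub>0, \<dots>, X\<^sub>n = x\<^sub>n\<close> is
  \<open>P x\<^sub>0 x\<^sub>1 \<cdots> P x\<^sub>n\<^sub>-\<^sub>1 x\<^sub>n\<close> if \<open>x\<^sub>0 = x\<close> and zero otherwise.\<close>

definition is_markov_law ::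
    "('v \<Rightarrow> 'v \<Rightarrow> real) \<Rightarrow> 'v \<Rightarrow> 'v stream measure \<Rightarrow> bool" where
  "is_markov_law P x M \<longleftrightarrow>
     prob_space M \<and> sets M = sets (stream_space (count_space UNIV)) \<and>
     (\<forall>xs. xs \<noteq> [] \<longrightarrow>
        measure M {\<omega> \<in> space M. \<forall>i<length xs. \<omega> !! i = xs ! i} =
        (if hd xs = x then \<Prod>i<length xs - 1. P (xs ! i) (xs ! Suc i) else 0))"

definition markov_law :: "('v \<Rightarrow> 'v \<Rightarrow> real) \<Rightarrow> 'v \<Rightarrow> 'v stream measure" where
  "markov_law P x = (THE M. is_markov_law P x M)"

definition recurrent :: "('v \<Rightarrow> 'v \<Rightarrow> real) \<Rightarrow> 'v \<Rightarrow> bool" where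
  "recurrent P x \<longleftrightarrow>
     measure (markov_law P x) {\<omega> \<in> space (markov_law P x). infinite {n. \<omega> !! n = x}} = 1"

definition transient :: "('v \<Rightarrow> 'v \<Rightarrow> real) \<Rightarrow> 'v \<Rightarrow> bool" where
  "transient P x \<longleftrightarrow> \<not> recurrent P x"

definition recurrent_component :: "('v \<Rightarrow> 'v \<Rightarrow> real) \<Rightarrow> 'v set \<Rightarrow> bool" where
  "recurrent_component P C \<longleftrightarrow> (\<forall>x\<in>C. recurrent P x)"

definition transient_component :: "('v \<Rightarrow> 'v \<Rightarrow> real) \<Rightarrow> 'v set \<Rightarrow> bool" where
  "transient_component P C \<longleftrightarrow> (\<forall>x\<in>C. transient P x)"

definition laplacian ::
    "('v \<Rightarrow> 'v \<Rightarrow> 'k::linordered_field) \<Rightarrow> ('v \<Rightarrow> 'k) \<Rightarrow> 'v \<Rightarrow> 'k" where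
  "laplacian b f x = (1 / deg b x) * (\<Sum>y\<in>nbrs b x. b x y * (f x - f y))"

definition equilibrium ::
    "('v \<Rightarrow> 'v \<Rightarrow> 'k::linordered_field) \<Rightarrow> 'v set \<Rightarrow> 'v \<Rightarrow> 'v \<Rightarrow> 'k" where
  "equilibrium b K a =
     (THE v. (\<forall>x\<in>K - {a}. laplacian b v x = 0) \<and> v a = 1 \<and> (\<forall>x. x \<notin> K \<longrightarrow> v x = 0))"

definition cap :: "('v \<Rightarrow> 'v \<Rightarrow> 'k::linordered_field) \<Rightarrow> 'v set \<Rightarrow> 'v \<Rightarrow> 'k" where
  "cap b K a = deg b a * laplacian b (equilibrium b K a) a"

text \<open>Division in \<open>ereal\<close>, where \<open>1 / 0 = \<infinity>\<close>.\<close>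

definition green_on :: "('v \<Rightarrow> 'v \<Rightarrow> 'k::linordered_field) \<Rightarrow> 'v set \<Rightarrow> 'v \<Rightarrow> ereal" where
  "green_on b K a = 1 / ereal (real_part (cap b K a / deg b a))"

definition exhaustion ::
    "('v \<Rightarrow> 'v \<Rightarrow> 'k::linordered_field) \<Rightarrow> (nat \<Rightarrow> 'v set) \<Rightarrow> bool" where
  "exhaustion b K \<longleftrightarrow>
     (\<forall>n. finite (K n) \<and> connected_on b (K n)) \<and> incseq K \<and> (\<Union>n. K n) = UNIV"

definition green ::
    "('v \<Rightarrow> 'v \<Rightarrow> 'k::linordered_field) \<Rightarrow> (nat \<Rightarrow> 'v set) \<Rightarrow> 'v \<Rightarrow> ereal" where
  "green b K a = limsup (\<lambda>n. green_on b (K n) a)"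

text \<open>Well-definedness of the Markov chain: for stochastic \<open>P\<close> the law exists and is unique, and the
  matrix \<open>real_transition b\<close> is stochastic.\<close>

lemma markov_law_unique:
  fixes P :: "'v::countable \<Rightarrow> 'v \<Rightarrow> real"
  assumes M: "is_markov_law P x M" and N: "is_markov_law P x N"
  shows "M = N"
proof -
  interpret M: prob_space M using M by (simp add: is_markov_law_def)
  interpret N: prob_space N using N by (simp add: is_markov_law_def)
  have sM: "sets M = sets (stream_space (count_space UNIV))"
    and sN: "sets N = sets (stream_space (count_space UNIV))"
    using M N by (auto simp: is_markov_law_def)
  have spM: "space M = UNIV" and spN: "space N = UNIV"
    using sets_eq_imp_space_eq[OF sM] sets_eq_imp_space_eq[OF sN] by (auto simp: space_stream_space)
  have eq: "sstart UNIV xs = {\<omega>. \<forall>i<length xs. \<omega> !! i = xs ! i}" for xs :: "'v list"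
    using sstart_eq[of _ "UNIV::'v set" xs] by auto
  show ?thesis
  proof (rule stream_space_eq_sstart[of UNIV])
    fix xs :: "'v list" assume "xs \<noteq> []"
    then have "measure M (sstart UNIV xs) = measure N (sstart UNIV xs)"
      using M N by (simp add: is_markov_law_def eq spM spN)
    then show "emeasure M (sstart UNIV xs) = emeasure N (sstart UNIV xs)"
      by (simp add: M.emeasure_eq_measure N.emeasure_eq_measure)
  qed (use sM sN M.prob_space_axioms N.prob_space_axioms in auto)
qed

lemma markov_law_exists:
  fixes K :: "'v::countable \<Rightarrow> 'v pmf"
  shows "\<exists>M. is_markov_law (\<lambda>x y. pmf (K x) y) x M"
proof -
  define Q :: "nat \<Rightarrow> (nat \<Rightarrow> 'v) \<Rightarrow> 'v measure" where
    "Q n \<omega> = (if n = 0 then return (count_space UNIV) x else measure_pmf (K (\<omega> (n - 1))))" for n \<omega>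
  define S :: "nat \<Rightarrow> 'v measure" where "S = (\<lambda>_. count_space UNIV)"
  have K_meas: "(\<lambda>y. measure_pmf (K y)) \<in> measurable (count_space UNIV) (subprob_algebra (count_space UNIV))"
    by (rule measurable_measure_pmf)
  interpret IT: Ionescu_Tulcea Q S
  proof (rule Ionescu_Tulcea.intro)
    fix n
    show "Q n \<in> measurable (PiM {0..<n} S) (subprob_algebra (S n))"
    proof (cases n)
      case 0
      then have "Q n = (\<lambda>_. return (count_space UNIV) x)" by (auto simp: Q_def)
      then show ?thesis
        by (auto simp: S_def space_subprob_algebra
            intro!: measurable_const prob_space_imp_subprob_space prob_space_return)
    next
      case (Suc m)
      have "(\<lambda>\<omega>. \<omega> m) \<in> measurable (PiM {0..<n} S) (count_space UNIV)"
        using measurable_component_singleton[of m "{0..<n}" S] Suc by (simp add: S_def)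
      from measurable_compose[OF this K_meas] show ?thesis
        by (simp add: Q_def[abs_def] S_def Suc)
    qed
  next
    fix n \<omega> assume "\<omega> \<in> space (PiM {0..<n} S)"
    show "prob_space (Q n \<omega>)"
      by (auto simp: Q_def prob_space_return prob_space_measure_pmf)
  qed
  define c where "c n w = (if n = 0 \<or> w 0 = x then \<Prod>i<n - 1. pmf (K (w i)) (w (Suc i)) else 0)"
    for n and w :: "nat \<Rightarrow> 'v"
  define A where "A n w = {\<omega> \<in> space (PiM {0..<n} S). \<forall>i<n. \<omega> i = w i}" for n and w :: "nat \<Rightarrow> 'v"
  have u: "(\<lambda>_. undefined) \<in> space (PiM {0..<0} S)"
    by (simp add: space_PiM)
  have A_eq: "A n w = PiE {0..<n} (\<lambda>i. {w i})" for n w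
    unfolding A_def by (auto simp: space_PiM S_def PiE_iff extensional_def)
  have A_sets: "A n w \<in> sets (PiM {0..<n} S)" for n w
    unfolding A_eq by (intro sets_PiM_I_finite) (auto simp: S_def)
  have C: "emeasure (IT.C 0 n (\<lambda>_. undefined)) (A n w) = ennreal (c n w)" for n w
  proof (induction n)
    case 0
    show ?case using u by (simp add: c_def A_def space_PiM PiM_empty)
  next
    case (Suc n)
    let ?C = "IT.C 0 n (\<lambda>_. undefined)"
    define p where "p = (if n = 0 then if w 0 = x then 1 else 0 else pmf (K (w (n - 1))) (w n))"
    have p0: "0 \<le> p" by (simp add: p_def)
    have spC: "space ?C = space (PiM {0..<n} S)" using IT.space_C[OF u, of n] by simp
    have sC: "sets ?C = sets (PiM {0..<n} S)" using IT.sets_C[OF u, of n] by simp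
    have step: "emeasure (IT.eP n \<omega>) (A (Suc n) w) = ennreal p * indicator (A n w) \<omega>"
      if \<omega>: "\<omega> \<in> space ?C" for \<omega>
    proof -
      have \<omega>': "\<omega> \<in> space (PiM {0..<n} S)" using \<omega> spC by simp
      have upd: "fun_upd \<omega> n y \<in> A (Suc n) w \<longleftrightarrow> \<omega> \<in> A n w \<and> y = w n" for y
        using \<omega>' unfolding A_eq space_PiM S_def
        by (auto simp: PiE_iff extensional_def less_Suc_eq)
      have "emeasure (IT.eP n \<omega>) (A (Suc n) w) =
          emeasure (Q n \<omega>) ((\<lambda>y. fun_upd \<omega> n y) -` A (Suc n) w \<inter> space (S n))"
        by (rule IT.emeasure_eP[OF \<omega>' A_sets])
      also have "(\<lambda>y. fun_upd \<omega> n y) -` A (Suc n) w \<inter> space (S n) = (if \<omega> \<in> A n w then {w n} else {})"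
        using upd by (auto simp: S_def)
      also have "emeasure (Q n \<omega>) \<dots> = ennreal p * indicator (A n w) \<omega>"
      proof (cases "\<omega> \<in> A n w")
        case True
        then have "n \<noteq> 0 \<Longrightarrow> \<omega> (n - 1) = w (n - 1)" by (auto simp: A_def)
        then show ?thesis using True
          by (auto simp: Q_def p_def emeasure_pmf_single split: split_indicator)
      qed simp
      finally show ?thesis .
    qed
    have "emeasure (IT.C 0 (Suc n) (\<lambda>_. undefined)) (A (Suc n) w) =
        (\<integral>\<^sup>+\<omega>. emeasure (IT.eP n \<omega>) (A (Suc n) w) \<partial>?C)"
    proof -
      have "IT.eP n \<in> measurable ?C (subprob_algebra (PiM {0..<Suc n} S))"
        using IT.measurable_eP[of n] by (simp add: measurable_cong_sets[OF sC refl])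
      moreover have "space ?C \<noteq> {}"
        using prob_space.not_empty[OF IT.prob_space_C[OF u, of n]] .
      ultimately show ?thesis
        using emeasure_bind[of ?C "IT.eP n" "PiM {0..<Suc n} S" "A (Suc n) w"] A_sets by simp
    qed
    also have "\<dots> = (\<integral>\<^sup>+\<omega>. ennreal p * indicator (A n w) \<omega> \<partial>?C)"
      by (intro nn_integral_cong step)
    also have "\<dots> = ennreal p * ennreal (c n w)"
      using Suc.IH A_sets sC by (subst nn_integral_cmult_indicator) auto
    also have "\<dots> = ennreal (c (Suc n) w)"
    proof -
      have "p * c n w = c (Suc n) w"
        by (cases n) (auto simp: p_def c_def)
      then show ?thesis using p0 by (metis ennreal_mult')
    qed
    finally show ?case .
  qed
  define N where "N = distr IT.PF.lim (stream_space (count_space UNIV)) to_stream"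
  have sL: "sets IT.PF.lim = sets (PiM UNIV (\<lambda>_. count_space UNIV))"
    using IT.PF.sets_lim by (simp add: S_def)
  have to: "to_stream \<in> measurable IT.PF.lim (stream_space (count_space UNIV))"
    by (subst measurable_cong_sets[OF sL refl]) (rule measurable_to_stream)
  have pL: "prob_space IT.PF.lim"
  proof
    have "emeasure IT.PF.lim (prod_emb UNIV S {0..<0} (A 0 undefined)) = emeasure (IT.CI {0..<0}) (A 0 undefined)"
      by (rule IT.lim) (rule finite_atLeastLessThan, rule A_sets)
    also have "\<dots> = emeasure (IT.C 0 0 (\<lambda>_. undefined)) (prod_emb {0..<0} S {0..<0} (A 0 undefined))"
      by (rule IT.emeasure_CI) (rule subset_refl, rule A_sets)
    also have "prod_emb {0..<0} S {0..<0} (A 0 undefined) = A 0 undefined"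
      by (auto simp: prod_emb_def A_def space_PiM)
    also have "emeasure (IT.C 0 0 (\<lambda>_. undefined)) (A 0 undefined) = 1"
      using C[of 0] by (simp add: c_def)
    also have "prod_emb UNIV S {0..<0} (A 0 undefined) = space IT.PF.lim"
      using sets_eq_imp_space_eq[OF IT.PF.sets_lim] by (auto simp: prod_emb_def A_def space_PiM)
    finally show "emeasure IT.PF.lim (space IT.PF.lim) = 1" .
  qed
  have pN: "prob_space N" unfolding N_def by (rule prob_space.prob_space_distr[OF pL to])
  have spL: "space IT.PF.lim = UNIV" 
    using sets_eq_imp_space_eq[OF sL] by (simp add: space_PiM)
  have "is_markov_law (\<lambda>x y. pmf (K x) y) x N"
    unfolding is_markov_law_def
  proof (intro conjI allI impI pN)
    show "sets N = sets (stream_space (count_space UNIV))" by (simp add: N_def)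
    fix xs :: "'v list" assume xs: "xs \<noteq> []"
    let ?n = "length xs" and ?w = "\<lambda>i. xs ! i"
    let ?Z = "{\<omega> \<in> space N. \<forall>i<length xs. \<omega> !! i = xs ! i}"
    have Z: "?Z = sstart UNIV xs"
      using sstart_eq[of _ "UNIV::'v set" xs] by (auto simp: N_def space_stream_space)
    have "emeasure N ?Z = emeasure IT.PF.lim (to_stream -` ?Z \<inter> space IT.PF.lim)"
      unfolding Z unfolding N_def by (rule emeasure_distr[OF to sets_sstart])
    also have "to_stream -` ?Z \<inter> space IT.PF.lim = prod_emb UNIV S {0..<?n} (A ?n ?w)"
      unfolding spL by (auto simp: prod_emb_def A_def N_def space_stream_space space_PiM S_def to_stream_def)
    also have "emeasure IT.PF.lim \<dots> = emeasure (IT.CI {0..<?n}) (A ?n ?w)"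
      by (rule IT.lim) (rule finite_atLeastLessThan, rule A_sets)
    also have "\<dots> = emeasure (IT.C 0 ?n (\<lambda>_. undefined)) (prod_emb {0..<?n} S {0..<?n} (A ?n ?w))"
      by (rule IT.emeasure_CI) (rule subset_refl, rule A_sets)
    also have "prod_emb {0..<?n} S {0..<?n} (A ?n ?w) = A ?n ?w"
      by (rule prod_emb_id) (auto simp: A_def space_PiM)
    also have "emeasure (IT.C 0 ?n (\<lambda>_. undefined)) (A ?n ?w) = ennreal (c ?n ?w)"
      by (rule C)
    finally have "measure N ?Z = c ?n ?w"
      by (simp add: measure_def c_def prod_nonneg)
    then show "measure N ?Z =
        (if hd xs = x then \<Prod>i<length xs - 1. pmf (K (xs ! i)) (xs ! Suc i) else 0)"
      using xs by (simp add: c_def hd_conv_nth)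
  qed
  then show ?thesis ..
qed

lemma is_markov_law_markov_law:
  fixes P :: "'v::countable \<Rightarrow> 'v \<Rightarrow> real"
  assumes "\<And>x y. P x y = pmf (K x) y"
  shows "is_markov_law P x (markov_law P x)"
proof -
  have P: "P = (\<lambda>x y. pmf (K x) y)" using assms by (intro ext)
  show ?thesis
    unfolding markov_law_def
    using markov_law_exists[of K x] unfolding P[symmetric]
    by (metis markov_law_unique theI)
qed

lemma real_part_lower:
  fixes k :: "'k::linordered_field"
  assumes "\<bar>k\<bar> < of_rat c" and "of_rat q \<le> k"
  shows "of_rat q \<le> real_part k"
  unfolding real_part_def
proof (rule cSup_upper)
  show "bdd_above {real_of_rat q |q. of_rat q \<le> k}"
  proof (rule bdd_aboveI[of _ "real_of_rat c"])
    fix r assume "r \<in> {real_of_rat q |q. of_rat q \<le> k}"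
    then obtain p :: rat where p: "r = of_rat p" "of_rat p \<le> k" by auto
    then have "of_rat p < (of_rat c :: 'k)" using assms(1) by linarith
    then show "r \<le> of_rat c" by (simp add: p of_rat_less of_rat_less_eq)
  qed
qed (use assms in auto)

lemma real_part_upper:
  fixes k :: "'k::linordered_field"
  assumes "\<bar>k\<bar> < of_rat c" and "k \<le> of_rat q"
  shows "real_part k \<le> of_rat q"
  unfolding real_part_def
proof (rule cSup_least)
  have "of_rat (- c) \<le> k" using assms(1) by (simp add: of_rat_minus)
  then show "{real_of_rat q |q. of_rat q \<le> k} \<noteq> {}" by blast
  fix r assume "r \<in> {real_of_rat q |q. of_rat q \<le> k}"
  then obtain p :: rat where p: "r = of_rat p" "of_rat p \<le> k" by auto
  then have "of_rat p \<le> (of_rat q :: 'k)" using assms(2) by linarith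
  then show "r \<le> of_rat q" by (simp add: p of_rat_less_eq)
qed

lemma real_part_of_rat: "real_part (of_rat q :: 'k::linordered_field) = of_rat q"
proof -
  have "\<bar>of_rat q :: 'k\<bar> = of_rat \<bar>q\<bar>"
    by (metis abs_of_nonneg abs_of_nonpos linear of_rat_0 of_rat_less_eq of_rat_minus)
  also have "\<dots> < of_rat (\<bar>q\<bar> + 1)" by (simp only: of_rat_less)
  finally have "\<bar>of_rat q :: 'k\<bar> < of_rat (\<bar>q\<bar> + 1)" .
  from real_part_lower[OF this, of q] real_part_upper[OF this, of q] show ?thesis by simp
qed

lemma real_part_add:
  fixes k l :: "'k::linordered_field"
  assumes k: "\<bar>k\<bar> < of_rat c" and l: "\<bar>l\<bar> < of_rat d"
  shows "real_part (k + l) = real_part k + real_part l"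
proof -
  have kl: "\<bar>k + l\<bar> < of_rat (c + d)" using k l by (simp add: of_rat_add)
  show ?thesis
  proof (rule antisym; rule ccontr)
    assume "\<not> real_part (k + l) \<le> real_part k + real_part l"
    then obtain e where e: "e > 0" "real_part k + real_part l + 2 * e = real_part (k + l)"
      by (intro that[of "(real_part (k + l) - real_part k - real_part l) / 2"]) (auto simp: field_simps)
    obtain p where p: "real_part k < of_rat p" "of_rat p < real_part k + e"
      using of_rat_dense[of "real_part k" "real_part k + e"] e by auto
    obtain q where q: "real_part l < of_rat q" "of_rat q < real_part l + e"
      using of_rat_dense[of "real_part l" "real_part l + e"] e by auto
    have "k \<le> of_rat p" using real_part_lower[OF k, of p] p by linarith
    moreover have "l \<le> of_rat q" using real_part_lower[OF l, of q] q by linarith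
    ultimately have "k + l \<le> of_rat (p + q)" by (simp add: of_rat_add)
    from real_part_upper[OF kl this] show False using p q e by (simp add: of_rat_add)
  next
    assume "\<not> real_part k + real_part l \<le> real_part (k + l)"
    then obtain e where e: "e > 0" "real_part k + real_part l - 2 * e = real_part (k + l)"
      by (intro that[of "(real_part k + real_part l - real_part (k + l)) / 2"]) (auto simp: field_simps)
    obtain p where p: "real_part k - e < of_rat p" "of_rat p < real_part k"
      using of_rat_dense[of "real_part k - e" "real_part k"] e by auto
    obtain q where q: "real_part l - e < of_rat q" "of_rat q < real_part l"
      using of_rat_dense[of "real_part l - e" "real_part l"] e by auto
    have "of_rat p \<le> k" using real_part_upper[OF k, of p] p by linarith
    moreover have "of_rat q \<le> l" using real_part_upper[OF l, of q] q by linarith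
    ultimately have "of_rat (p + q) \<le> k + l" by (simp add: of_rat_add)
    from real_part_lower[OF kl this] show False using p q e by (simp add: of_rat_add)
  qed
qed

lemma real_part_sum:
  fixes f :: "'a \<Rightarrow> 'k::linordered_field"
  assumes "finite A" and "\<And>a. a \<in> A \<Longrightarrow> \<exists>c. \<bar>f a\<bar> < of_rat c"
  shows "real_part (\<Sum>a\<in>A. f a) = (\<Sum>a\<in>A. real_part (f a)) \<and> (\<exists>c. \<bar>\<Sum>a\<in>A. f a\<bar> < of_rat c)"
  using assms
proof (induction A rule: finite_induct)
  case empty
  have "\<bar>0 :: 'k\<bar> < of_rat 1" by simp
  then have "\<exists>c. \<bar>0 :: 'k\<bar> < of_rat c" by blast
  then show ?case using real_part_of_rat[where 'k = 'k, of 0] by simp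
next
  case (insert x F)
  then obtain c d where c: "\<bar>f x\<bar> < of_rat c" and d: "\<bar>\<Sum>a\<in>F. f a\<bar> < of_rat d" by blast
  have "\<bar>f x + (\<Sum>a\<in>F. f a)\<bar> < of_rat (c + d)" using c d by (simp add: of_rat_add)
  then show ?case using insert real_part_add[OF c d] by auto
qed

lemma real_transition_pmf:
  fixes b :: "'v \<Rightarrow> 'v \<Rightarrow> 'k::linordered_field"
  assumes "weighted_graph b" and "locally_finite b" and deg: "\<And>x. 0 < deg b x"
  shows "\<exists>K. \<forall>x y. real_transition b x y = pmf (K x) y"
proof -
  have nn: "0 \<le> b x y" for x y using assms(1) by (simp add: weighted_graph_def)
  have fin: "finite (nbrs b x)" for x using assms(2) by (simp add: locally_finite_def)
  have zero: "real_part (0 :: 'k) = 0" using real_part_of_rat[where 'k = 'k, of 0] by simp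
  have off: "real_transition b x y = 0" if "y \<notin> nbrs b x" for x y
  proof -
    have "b x y = 0" using that nn[of x y] by (simp add: nbrs_def adj_def)
    then show ?thesis by (simp add: real_transition_def zero)
  qed
  have le1: "b x y / deg b x \<le> 1" for x y
  proof (cases "y \<in> nbrs b x")
    case True
    then have "b x y \<le> deg b x" unfolding deg_def using fin nn by (intro member_le_sum) auto
    then show ?thesis using deg[of x] by simp
  next
    case False
    then have "b x y = 0" using nn[of x y] by (simp add: nbrs_def adj_def)
    then show ?thesis by simp
  qed
  have ge0: "0 \<le> b x y / deg b x" for x y using nn deg[of x] by (simp add: less_imp_le)
  have bd: "\<bar>b x y / deg b x\<bar> < of_rat 2" for x y
  proof -
    have "\<bar>b x y / deg b x\<bar> \<le> 1" using le1[of x y] ge0[of x y] by linarith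
    also have "(1 :: 'k) < of_rat 2" by simp
    finally show ?thesis .
  qed
  have nonneg: "0 \<le> real_transition b x y" for x y
    using real_part_lower[OF bd, of 0] ge0 by (simp add: real_transition_def)
  have sum1: "(\<Sum>y\<in>nbrs b x. real_transition b x y) = 1" for x
  proof -
    have "(\<Sum>y\<in>nbrs b x. real_transition b x y) = real_part (\<Sum>y\<in>nbrs b x. b x y / deg b x)"
      unfolding real_transition_def using real_part_sum[OF fin, of _ "\<lambda>y. b x y / deg b x"] bd by metis
    also have "(\<Sum>y\<in>nbrs b x. b x y / deg b x) = of_rat 1"
      using deg[of x] by (simp add: sum_divide_distrib[symmetric] deg_def)
    finally show ?thesis using real_part_of_rat[where 'k = 'k, of 1] by simp
  qed
  have "pmf (embed_pmf (real_transition b x)) y = real_transition b x y" for x y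
  proof (rule pmf_embed_pmf[OF nonneg])
    have "(\<integral>\<^sup>+y. ennreal (real_transition b x y) \<partial>count_space UNIV) =
        (\<Sum>y\<in>nbrs b x. ennreal (real_transition b x y))"
      using off fin by (intro nn_integral_count_space') auto
    also have "\<dots> = 1" using sum1[of x] nonneg by (subst sum_ennreal) auto
    finally show "(\<integral>\<^sup>+y. ennreal (real_transition b x y) \<partial>count_space UNIV) = 1" .
  qed
  then show ?thesis by (intro exI[of _ "\<lambda>x. embed_pmf (real_transition b x)"]) simp
qed

end

theory Submission
  imports Defs
begin

text \<open>Taking real parts turns the equilibrium potential of a finite set \<open>F\<close> into the solution of the
  Dirichlet problem of the real chain on \<open>C \<inter> F\<close>. By the maximum principle on the closed class \<open>C\<close> it
  lies below the probability of ever hitting \<open>a\<close>, and along an exhaustion it eventually dominates the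
  probability of hitting \<open>a\<close> within \<open>n\<close> steps, for each \<open>n\<close>. Hence \<open>G(a) = 1 / (1 - r)\<close>, where \<open>r\<close> is
  the return probability of \<open>a\<close>, and \<open>a\<close> is recurrent if and only if \<open>r = 1\<close>.\<close>

subsection \<open>Return probabilities of a Markov chain\<close>

text \<open>The ordered field may lack limits, so none is taken in it: each finite Dirichlet problem
  is solved algebraically, and only real sequences converge. Real parts commute with finite sums and
  with products of nonnegative bounded elements; this suffices because edge probabilities and
  potentials lie between 0 and 1.

  The obstacle is the loss of edges: an infinitesimal transition probability has real part 0, so the
  real chain need not inherit connectedness, and the real Dirichlet problem on all of
  \<open>F\<close> may have several solutions. An edge survives exactly when its weight is
  comparable to the degree of its start. Hence an essential component is closed and communicating
  for the real chain, and this replaces connectedness in the upper bound. The lower bound uses a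
  finite horizon, for which only finitely many vertices matter and all of them eventually lie in the
  exhausting set.\<close>

lemma ex_snth_Suc:
  "(\<exists>i. Suc n \<le> i \<and> (x ## \<omega>) !! i = a) \<longleftrightarrow> (\<exists>i. n \<le> i \<and> \<omega> !! i = a)"
proof
  assume "\<exists>i. Suc n \<le> i \<and> (x ## \<omega>) !! i = a"
  then obtain i where "Suc n \<le> i" "(x ## \<omega>) !! i = a" by blast
  then show "\<exists>i. n \<le> i \<and> \<omega> !! i = a" by (cases i) auto
next
  assume "\<exists>i. n \<le> i \<and> \<omega> !! i = a"
  then obtain i where "Suc n \<le> Suc i" "(x ## \<omega>) !! Suc i = a" by auto
  then show "\<exists>i. Suc n \<le> i \<and> (x ## \<omega>) !! i = a" by blast
qed

locale finite_kernel =
  fixes K :: "'v::countable \<Rightarrow> 'v pmf"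
  assumes finite_support: "finite (set_pmf (K x))"
begin

definition law :: "'v \<Rightarrow> 'v stream measure" where
  "law x = markov_law (\<lambda>x y. pmf (K x) y) x"

text \<open>The transition operator. A finite sum over the support commutes with pointwise limits
  without any domination argument.\<close>

definition avg :: "('v \<Rightarrow> real) \<Rightarrow> 'v \<Rightarrow> real" where
  "avg f x = (\<Sum>y\<in>set_pmf (K x). pmf (K x) y * f y)"

lemma avg_mono: "(\<And>y. y \<in> set_pmf (K x) \<Longrightarrow> f y \<le> g y) \<Longrightarrow> avg f x \<le> avg g x"
  unfolding avg_def by (intro sum_mono mult_left_mono) auto

lemma avg_const: "avg (\<lambda>_. c) x = c"
  using sum_pmf_eq_1[OF finite_support subset_refl, of x]
  by (simp add: avg_def flip: sum_distrib_right)

lemma avg_diff: "avg (\<lambda>y. f y - g y) x = avg f x - avg g x"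
  by (simp add: avg_def right_diff_distrib sum_subtractf)

lemma avg_cmult: "avg (\<lambda>y. f y * c) x = avg f x * c"
  by (simp add: avg_def sum_distrib_right mult.assoc)

lemma avg_tendsto:
  assumes "\<And>y. y \<in> set_pmf (K x) \<Longrightarrow> (\<lambda>n. f n y) \<longlonglongrightarrow> g y"
  shows "(\<lambda>n. avg (f n) x) \<longlonglongrightarrow> avg g x"
  unfolding avg_def by (intro tendsto_sum tendsto_mult tendsto_const assms)

text \<open>The weights are positive with sum 1, so an average that reaches an upper bound of its
  values leaves no room for a smaller value. All propagation arguments for the real chain rest on
  this equality case.\<close>

lemma avg_eq_boundD:
  assumes le: "\<And>y. y \<in> set_pmf (K x) \<Longrightarrow> f y \<le> m" and eq: "m \<le> avg f x"
    and y: "y \<in> set_pmf (K x)"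
  shows "f y = m"
proof -
  have "(\<Sum>y\<in>set_pmf (K x). pmf (K x) y * (m - f y)) = 0"
  proof (rule antisym)
    have "(\<Sum>y\<in>set_pmf (K x). pmf (K x) y * (m - f y)) = m - avg f x"
      using avg_diff[of "\<lambda>_. m" f x] by (simp add: avg_const avg_def)
    then show "(\<Sum>y\<in>set_pmf (K x). pmf (K x) y * (m - f y)) \<le> 0" using eq by simp
  qed (intro sum_nonneg mult_nonneg_nonneg, use le in auto)
  then have "pmf (K x) y * (m - f y) = 0"
    using y le finite_support by (subst (asm) sum_nonneg_eq_0_iff) (auto intro!: mult_nonneg_nonneg)
  then show ?thesis using y by (simp add: set_pmf_iff)
qed

section \<open>The law on path space and its one-step decomposition\<close>

lemma is_markov_law_law: "is_markov_law (\<lambda>x y. pmf (K x) y) x (law x)"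
  unfolding law_def by (rule is_markov_law_markov_law[of _ K]) simp

lemma sets_law [measurable_cong]: "sets (law x) = sets (stream_space (count_space UNIV))"
  using is_markov_law_law[of x] by (simp add: is_markov_law_def)

lemma space_law [simp]: "space (law x) = UNIV"
  using sets_eq_imp_space_eq[OF sets_law] by (auto simp: space_stream_space)

lemma prob_space_law: "prob_space (law x)"
  using is_markov_law_law[of x] by (simp add: is_markov_law_def)

lemma measure_law_cylinder:
  "xs \<noteq> [] \<Longrightarrow> measure (law x) {\<omega>. \<forall>i<length xs. \<omega> !! i = xs ! i} =
    (if hd xs = x then \<Prod>i<length xs - 1. pmf (K (xs ! i)) (xs ! Suc i) else 0)"
  using is_markov_law_law[of x] by (simp add: is_markov_law_def)

abbreviation shifted_law :: "'v \<Rightarrow> 'v \<Rightarrow> 'v stream measure" where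
  "shifted_law x y \<equiv> distr (law y) (stream_space (count_space UNIV)) ((##) x)"

lemma shifted_law_kernel:
  "shifted_law x \<in> measure_pmf (K x) \<rightarrow>\<^sub>M subprob_algebra (stream_space (count_space UNIV))"
proof -
  have m: "(##) x \<in> law y \<rightarrow>\<^sub>M stream_space (count_space UNIV)" for y by measurable
  have "shifted_law x y \<in> space (subprob_algebra (stream_space (count_space UNIV)))" for y
    by (simp add: space_subprob_algebra prob_space_imp_subprob_space
        prob_space.prob_space_distr[OF prob_space_law m])
  then show ?thesis by simp
qed

lemma measure_bind_shifted_law:
  assumes "A \<in> sets (stream_space (count_space UNIV))"
  shows "measure (measure_pmf (K x) \<bind> shifted_law x) A = avg (\<lambda>y. measure (law y) ((##) x -` A)) x"
proof -
  have m: "(##) x \<in> law y \<rightarrow>\<^sub>M stream_space (count_space UNIV)" for y by measurable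
  have "measure (measure_pmf (K x) \<bind> shifted_law x) A = (\<integral>y. measure (shifted_law x y) A \<partial>K x)"
    by (rule measure_pmf.measure_bind[OF shifted_law_kernel assms])
  also have "\<dots> = (\<integral>y. measure (law y) ((##) x -` A) \<partial>K x)"
    by (simp add: measure_distr[OF m assms])
  also have "\<dots> = avg (\<lambda>y. measure (law y) ((##) x -` A)) x"
    by (subst integral_measure_pmf[OF finite_support]) (simp_all add: avg_def)
  finally show ?thesis .
qed

text \<open>Cylinder probabilities determine the law, so it suffices that drawing the second state
  from \<open>K x\<close> and prepending \<open>x\<close> gives the right product on
  cylinders.\<close>

lemma law_one_step: "law x = measure_pmf (K x) \<bind> shifted_law x" (is "_ = ?N")
proof -
  let ?S = "stream_space (count_space UNIV) :: 'v stream measure"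
  have m: "(##) x \<in> law y \<rightarrow>\<^sub>M ?S" for y by measurable
  have sN: "sets ?N = sets ?S" by (rule sets_bind) simp_all
  have spN: "space ?N = UNIV" by (simp add: sets_eq_imp_space_eq[OF sN] space_stream_space)
  have pN: "prob_space ?N"
    by (rule measure_pmf.prob_space_bind[OF _ shifted_law_kernel])
      (simp add: prob_space.prob_space_distr[OF prob_space_law m])
  have "is_markov_law (\<lambda>x y. pmf (K x) y) x ?N"
    unfolding is_markov_law_def spN
  proof (intro conjI allI impI pN sN)
    fix xs :: "'v list" assume "xs \<noteq> []"
    then obtain z zs where xs: "xs = z # zs" by (cases xs) auto
    let ?E = "\<lambda>ys. {\<omega> :: 'v stream. \<forall>i<length ys. \<omega> !! i = ys ! i}"
    define c where "c = (\<Prod>i<length zs - 1. pmf (K (zs ! i)) (zs ! Suc i))"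
    have E: "?E ys \<in> sets ?S" for ys
    proof -
      have "?E ys = sstart UNIV ys" using sstart_eq[of _ "UNIV::'v set" ys] by auto
      then show ?thesis by (simp only: sstart_sets)
    qed
    have pre: "(##) x -` ?E xs = (if z = x then ?E zs else {})"
      by (intro set_eqI) (simp add: xs All_less_Suc2)
    have "measure ?N (?E xs) =
      (if z = x then avg (\<lambda>y. measure (law y) (?E zs)) x else 0)"
      unfolding measure_bind_shifted_law[OF E] pre by (cases "z = x") (simp_all add: avg_const)
    also have "avg (\<lambda>y. measure (law y) (?E zs)) x = 
      (\<Prod>i<length zs. pmf (K ((x # zs) ! i)) ((x # zs) ! Suc i))"
    proof (cases zs)
      case Nil
      have "measure (law y) UNIV = 1" for y
        using prob_space.prob_space[OF prob_space_law, of y] by simp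
      then show ?thesis using Nil by (simp add: avg_const)
    next
      case (Cons y ys)
      \<comment> \<open>Only the start \<open>w = y\<close> can charge this cylinder, so the average
        collapses to the term of \<open>y\<close>.\<close>
      have "measure (law w) (?E zs) = (if y = w then c else 0)" for w
        by (subst measure_law_cylinder) (simp_all add: c_def Cons)
      then have "avg (\<lambda>y. measure (law y) (?E zs)) x =
        (\<Sum>z\<in>set_pmf (K x). if y = z then pmf (K x) z * c else 0)"
        unfolding avg_def by (intro sum.cong refl) simp
      also have "\<dots> = pmf (K x) y * c"
        using finite_support by (simp add: set_pmf_iff)
      finally show ?thesis by (simp add: c_def Cons prod.lessThan_Suc_shift del: prod.lessThan_Suc)
    qed
    finally show "measure ?N {\<omega> \<in> UNIV. \<forall>i<length xs. \<omega> !! i = xs ! i} =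
      (if hd xs = x then \<Prod>i<length xs - 1. pmf (K (xs ! i)) (xs ! Suc i) else 0)"
      unfolding xs by simp
  qed
  then show ?thesis by (rule markov_law_unique[OF is_markov_law_law])
qed

text \<open>The Markov property at time 1; the first-step equations below are instances of
  it.\<close>

lemma measure_law_step:
  assumes "A \<in> sets (stream_space (count_space UNIV))"
  shows "measure (law x) A = avg (\<lambda>y. measure (law y) ((##) x -` A)) x"
  by (rule measure_bind_shifted_law[OF assms, folded law_one_step])

text \<open>Time 0 counts as a hit. Hence \<open>hit a a\<close> is 1, and the return probability of
  \<open>a\<close> is \<open>avg (hit a) a\<close> instead.\<close>

definition hit :: "'v \<Rightarrow> 'v \<Rightarrow> real" where
  "hit a x = measure (law x) {\<omega>. \<exists>i. \<omega> !! i = a}"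

definition hit_within :: "'v \<Rightarrow> nat \<Rightarrow> 'v \<Rightarrow> real" where
  "hit_within a n x = measure (law x) {\<omega>. \<exists>i\<le>n. \<omega> !! i = a}"

lemma sets_exists_index [measurable]:
  "{\<omega>. \<exists>i. P i \<and> \<omega> !! i = a} \<in> sets (stream_space (count_space UNIV))" for a :: 'v
proof -
  have "{\<omega> \<in> space (stream_space (count_space UNIV)). \<exists>i. P i \<and> \<omega> !! i = a}
    \<in> sets (stream_space (count_space UNIV))" by measurable
  then show ?thesis by (simp add: space_stream_space)
qed

lemma AE_starts: "AE \<omega> in law x. \<omega> !! 0 = x"
proof -
  interpret prob_space "law x" by (rule prob_space_law)
  have "{\<omega> \<in> space (stream_space (count_space UNIV)). \<omega> !! 0 = x} \<in> sets (stream_space (count_space UNIV))"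
    by measurable
  then have m: "{\<omega>. \<omega> !! 0 = x} \<in> events" by (simp add: space_stream_space sets_law)
  have "prob {\<omega>. \<omega> !! 0 = x} = 1"
    using measure_law_cylinder[of "[x]" x] by simp
  then show ?thesis using prob_eq_1[OF m] by simp
qed

lemma hit_self: "hit a a = 1"
proof -
  interpret prob_space "law a" by (rule prob_space_law)
  have "AE \<omega> in law a. \<omega> \<in> {\<omega>. \<exists>i. \<omega> !! i = a}"
    using AE_starts by eventually_elim blast
  then show ?thesis unfolding hit_def
    by (subst prob_eq_1) (use sets_exists_index[of "\<lambda>_. True" a] in \<open>auto simp: sets_law\<close>)
qed

lemma hit_within_0: "x \<noteq> a \<Longrightarrow> hit_within a 0 x = 0"
proof -
  assume "x \<noteq> a"
  interpret prob_space "law x" by (rule prob_space_law)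
  have "AE \<omega> in law x. \<omega> \<notin> {\<omega>. \<exists>i\<le>0. \<omega> !! i = a}"
    using AE_starts by eventually_elim (use \<open>x \<noteq> a\<close> in auto)
  then show ?thesis unfolding hit_within_def
    by (subst prob_eq_0) (use sets_exists_index[of "\<lambda>i. i \<le> 0" a] in \<open>auto simp: sets_law\<close>)
qed

lemma hit_step: "x \<noteq> a \<Longrightarrow> hit a x = avg (hit a) x"
proof -
  assume "x \<noteq> a"
  have ex: "(\<exists>i. (x ## \<omega>) !! i = a) \<longleftrightarrow> (\<exists>i. \<omega> !! i = a)" for \<omega>
  proof
    assume "\<exists>i. (x ## \<omega>) !! i = a"
    then obtain i where "(x ## \<omega>) !! i = a" by blast
    then show "\<exists>i. \<omega> !! i = a" using \<open>x \<noteq> a\<close> by (cases i) auto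
  next
    assume "\<exists>i. \<omega> !! i = a"
    then obtain i where "(x ## \<omega>) !! Suc i = a" by auto
    then show "\<exists>i. (x ## \<omega>) !! i = a" by blast
  qed
  show ?thesis
    unfolding hit_def[abs_def]
    using measure_law_step[of "{\<omega>. \<exists>i. \<omega> !! i = a}" x] sets_exists_index[of "\<lambda>_. True" a]
    by (simp add: vimage_def ex)
qed

lemma hit_within_Suc: "x \<noteq> a \<Longrightarrow> hit_within a (Suc n) x = avg (hit_within a n) x"
proof -
  assume "x \<noteq> a"
  have ex: "(\<exists>i\<le>Suc n. (x ## \<omega>) !! i = a) \<longleftrightarrow> (\<exists>i\<le>n. \<omega> !! i = a)" for \<omega>
    using \<open>x \<noteq> a\<close> Ex_less_Suc2[of "Suc n" "\<lambda>i. (x ## \<omega>) !! i = a"]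
    by (simp add: less_Suc_eq_le)
  show ?thesis
    unfolding hit_within_def[abs_def]
    using measure_law_step[of "{\<omega>. \<exists>i\<le>Suc n. \<omega> !! i = a}" x] sets_exists_index[of "\<lambda>i. i \<le> Suc n" a]
    by (simp add: vimage_def ex)
qed

lemma hit_within_tendsto: "(\<lambda>n. hit_within a n x) \<longlonglongrightarrow> hit a x"
proof -
  interpret prob_space "law x" by (rule prob_space_law)
  have "(\<lambda>n. hit_within a n x) \<longlonglongrightarrow> prob (\<Union>n. {\<omega>. \<exists>i\<le>n. \<omega> !! i = a})"
    unfolding hit_within_def
  proof (rule finite_Lim_measure_incseq)
    show "range (\<lambda>n. {\<omega>. \<exists>i\<le>n. \<omega> !! i = a}) \<subseteq> events"
      using sets_exists_index[of "\<lambda>i. i \<le> _" a] by (auto simp: sets_law)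
    show "incseq (\<lambda>n. {\<omega>. \<exists>i\<le>n. \<omega> !! i = a})"
      by (rule incseq_SucI) (auto intro: le_SucI)
  qed
  also have "(\<Union>n. {\<omega>. \<exists>i\<le>n. \<omega> !! i = a}) = {\<omega>. \<exists>i. \<omega> !! i = a}" by auto
  finally show ?thesis by (simp add: hit_def)
qed

lemma hit_nonneg: "0 \<le> hit a x" by (simp add: hit_def)

lemma hit_le_1: "hit a x \<le> 1"
  unfolding hit_def by (rule prob_space.prob_le_1[OF prob_space_law])

lemma hit_within_nonneg: "0 \<le> hit_within a n x" by (simp add: hit_within_def)

lemma hit_within_le_1: "hit_within a n x \<le> 1"
  unfolding hit_within_def by (rule prob_space.prob_le_1[OF prob_space_law])


lemma avg_hit_le: "avg (hit a) x \<le> hit a x"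
proof (cases "x = a")
  case True
  then show ?thesis using avg_mono[of x "hit a" "\<lambda>_. 1"] by (simp add: hit_le_1 hit_self avg_const)
qed (simp add: hit_step)

text \<open>Up to the factor \<open>g a\<close>, \<open>hit a\<close> is the least nonnegative
  superharmonic function with value 1 at \<open>a\<close>. The comparison is an induction on the
  horizon, which then tends to infinity.\<close>

lemma superharmonic_ge_hit:
  assumes sup: "\<And>x. avg g x \<le> g x" and nn: "\<And>x. 0 \<le> g x"
  shows "hit a x * g a \<le> g x"
proof -
  have "hit_within a n x * g a \<le> g x" for n x
  proof (induction n arbitrary: x)
    case 0
    show ?case using hit_within_le_1[of a 0 x] nn[of a] nn[of x]
      by (cases "x = a") (simp_all add: hit_within_0 mult_left_le_one_le hit_within_nonneg)
  next
    case (Suc n)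
    show ?case
    proof (cases "x = a")
      case True
      then show ?thesis
        by (simp add: mult_left_le_one_le nn hit_within_nonneg hit_within_le_1)
    next
      case False
      then have "hit_within a (Suc n) x * g a = avg (\<lambda>y. hit_within a n y * g a) x"
        by (simp add: hit_within_Suc avg_cmult)
      also have "\<dots> \<le> avg g x" by (intro avg_mono Suc.IH)
      finally show ?thesis using sup[of x] by simp
    qed
  qed
  then show ?thesis
    by (intro LIMSEQ_le_const2[OF tendsto_mult_right[OF hit_within_tendsto]]) auto
qed

section \<open>Reachability, almost sure return and recurrence\<close>

abbreviation reaches :: "'v \<Rightarrow> 'v \<Rightarrow> bool" where
  "reaches \<equiv> (\<lambda>x y. y \<in> set_pmf (K x))\<^sup>*\<^sup>*"

text \<open>The return hypothesis extends the mean value equation of \<open>hit a\<close> to the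
  point \<open>a\<close> itself, so the maximal value 1 spreads along every path from
  \<open>a\<close>.\<close>

lemma hit_eq_1_of_return:
  assumes ret: "avg (hit a) a = 1" and "reaches a x"
  shows "hit a x = 1"
  using assms(2)
proof induction
  case base
  show ?case by (rule hit_self)
next
  case (step y z)
  have "avg (hit a) y = 1" using step.IH ret by (cases "y = a") (simp_all add: hit_step)
  then show ?case using avg_eq_boundD[of y "hit a" 1 z] step.hyps by (simp add: hit_le_1)
qed

text \<open>\<open>hit c\<close> is superharmonic and, as \<open>a\<close> is hit almost surely, attains its minimum at \<open>a\<close>; hence it
  is constant on the states reachable from \<open>a\<close>.\<close>

lemma return_transfer:
  assumes ret: "avg (hit a) a = 1" and "reaches a c"
  shows "avg (hit c) c = 1"
proof -
  have ge: "hit c a \<le> hit c x" if "reaches a x" for x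
    using superharmonic_ge_hit[of "hit c" a x] hit_eq_1_of_return[OF ret that]
    by (simp add: avg_hit_le hit_nonneg)
  have eq: "hit c x = hit c a" if "reaches a x" for x
    using that
  proof induction
    case (step y z)
    have "- hit c z = - hit c a"
    proof (rule avg_eq_boundD[of y "\<lambda>z. - hit c z"])
      show "- hit c w \<le> - hit c a" if "w \<in> set_pmf (K y)" for w
        using ge[of w] step.hyps(1) that by (simp add: rtranclp.rtrancl_into_rtrancl)
      have "avg (\<lambda>z. - hit c z) y = - avg (hit c) y" by (simp add: avg_def sum_negf)
      then show "- hit c a \<le> avg (\<lambda>z. - hit c z) y" using avg_hit_le[of c y] step.IH by simp
    qed (rule step.hyps)
    then show ?case by simp
  qed simp
  \<comment> \<open>The constant is 1, since \<open>c\<close> is itself reachable from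
    \<open>a\<close> and \<open>hit c c\<close> is 1.\<close>
  have "hit c y = 1" if "y \<in> set_pmf (K c)" for y
    using eq[of c] eq[of y] that assms(2) hit_self[of c]
    by (simp add: rtranclp.rtrancl_into_rtrancl)
  then have "avg (hit c) c = avg (\<lambda>_. 1) c" by (simp add: avg_def)
  then show ?thesis by (simp add: avg_const)
qed

text \<open>All reachable starting states are treated at once, because the induction on
  \<open>n\<close> moves the start one step forward.\<close>

lemma measure_hit_later_eq_1:
  assumes ret: "avg (hit a) a = 1" and "reaches a x"
  shows "measure (law x) {\<omega>. \<exists>i. n \<le> i \<and> \<omega> !! i = a} = 1"
  using assms(2)
proof (induction n arbitrary: x)
  case 0
  then show ?case using hit_eq_1_of_return[OF ret, of x] by (simp add: hit_def)
next
  case (Suc n)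
  have "measure (law x) {\<omega>. \<exists>i. Suc n \<le> i \<and> \<omega> !! i = a} =
      avg (\<lambda>y. measure (law y) {\<omega>. \<exists>i. n \<le> i \<and> \<omega> !! i = a}) x"
    by (subst measure_law_step) (simp_all add: vimage_def ex_snth_Suc sets_exists_index)
  also have "\<dots> = avg (\<lambda>_. 1) x"
    unfolding avg_def
    by (intro sum.cong refl, subst Suc.IH) (auto intro: rtranclp.rtrancl_into_rtrancl[OF Suc.prems])
  finally show ?case by (simp add: avg_const)
qed

text \<open>Infinitely many visits means a visit at or after every time \<open>n\<close>. The event
  for \<open>n = 1\<close> has the return probability; if that is 1, all these countably many events
  are almost sure.\<close>

lemma recurrent_iff_return:
  "recurrent (\<lambda>x y. pmf (K x) y) a \<longleftrightarrow> avg (hit a) a = 1"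
proof -
  interpret prob_space "law a" by (rule prob_space_law)
  let ?I = "{\<omega>. infinite {n. \<omega> !! n = a}}"
  have rec: "recurrent (\<lambda>x y. pmf (K x) y) a \<longleftrightarrow> prob ?I = 1"
    using space_law[of a] unfolding recurrent_def law_def by simp
  have later: "{\<omega>. \<exists>i. n \<le> i \<and> \<omega> !! i = a} \<in> events" for n
    using sets_exists_index[of "\<lambda>i. n \<le> i" a] by (simp add: sets_law)
  have I: "?I = (\<Inter>n. {\<omega>. \<exists>i. n \<le> i \<and> \<omega> !! i = a})"
    by (auto simp: infinite_nat_iff_unbounded_le)
  have I_events: "?I \<in> events" unfolding I by (intro sets.countable_INT' later) auto
  have "(##) a -` {\<omega>. \<exists>i. 1 \<le> i \<and> \<omega> !! i = a} = {\<omega>. \<exists>i. \<omega> !! i = a}"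
    using ex_snth_Suc[of 0 a _ a] by (simp add: vimage_def)
  then have ret: "prob {\<omega>. \<exists>i. 1 \<le> i \<and> \<omega> !! i = a} = avg (hit a) a"
    by (subst measure_law_step) (simp_all add: sets_exists_index hit_def[abs_def])
  show ?thesis
  proof
    assume "recurrent (\<lambda>x y. pmf (K x) y) a"
    then have "1 \<le> prob {\<omega>. \<exists>i. 1 \<le> i \<and> \<omega> !! i = a}"
      unfolding rec using finite_measure_mono[of ?I, OF _ later[of 1]] by (auto simp: I)
    then show "avg (hit a) a = 1" using ret prob_le_1[of "{\<omega>. \<exists>i. 1 \<le> i \<and> \<omega> !! i = a}"] by linarith
  next
    assume "avg (hit a) a = 1"
    then have "AE \<omega> in law a. \<omega> \<in> {\<omega>. \<exists>i. n \<le> i \<and> \<omega> !! i = a}" for n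
      using measure_hit_later_eq_1[of a a n] prob_eq_1[OF later] by simp
    then have "AE \<omega> in law a. \<omega> \<in> ?I" unfolding I by (simp add: AE_all_countable)
    then show "recurrent (\<lambda>x y. pmf (K x) y) a" unfolding rec using prob_eq_1[OF I_events] by simp
  qed
qed

end

subsection \<open>Products of real parts\<close>

lemma real_part_0 [simp]: "real_part (0 :: 'k::linordered_field) = 0"
  using real_part_of_rat[where 'k = 'k, of 0] by simp

lemma real_part_1 [simp]: "real_part (1 :: 'k::linordered_field) = 1"
  using real_part_of_rat[where 'k = 'k, of 1] by simp

lemma rat_factors_above:
  fixes r s t :: real
  assumes "0 \<le> r" "0 \<le> s" "r * s < t"
  shows "\<exists>p q :: rat. r < of_rat p \<and> s < of_rat q \<and> of_rat p * of_rat q < t"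
proof -
  \<comment> \<open>For \<open>s = 0\<close> the quotient \<open>t / s\<close> would be the default
    0. Any bound above \<open>r\<close> then serves, since the product with \<open>s\<close>
    vanishes.\<close>
  have "r < (if s = 0 then r + 1 else t / s)" using assms by (simp add: field_simps)
  then obtain p where p: "r < of_rat p" "of_rat p < (if s = 0 then r + 1 else t / s)"
    using of_rat_dense by blast
  have "of_rat p * s < t" using p assms by (cases "s = 0") (auto simp: field_simps)
  moreover have p0: "0 < real_of_rat p" using p(1) assms by linarith
  ultimately have "s < t / of_rat p" by (simp add: field_simps)
  then obtain q where "s < of_rat q" "of_rat q < t / of_rat p"
    using of_rat_dense by blast
  then show ?thesis using p p0 by (intro exI[of _ p] exI[of _ q]) (simp add: field_simps)
qed

lemma rat_factors_below:
  fixes r s t :: real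
  assumes "0 \<le> r" "0 \<le> s" "0 \<le> t" "t < r * s"
  shows "\<exists>p q :: rat. 0 < p \<and> 0 < q \<and> of_rat p < r \<and> of_rat q < s \<and> t < of_rat p * of_rat q"
proof -
  \<comment> \<open>A zero factor would give \<open>r * s = 0\<close>, against
    \<open>0 \<le> t < r * s\<close>.\<close>
  have rs: "0 < r" "0 < s" using assms by (auto simp: less_le)
  then have "t / s < r" using assms by (simp add: field_simps)
  then obtain p where p: "t / s < of_rat p" "of_rat p < r" using of_rat_dense by blast
  have "0 \<le> t / s" using assms by simp
  then have p0: "0 < real_of_rat p" using p(1) by linarith
  then have "t / of_rat p < s" using p rs by (simp add: field_simps)
  then obtain q where q: "t / of_rat p < of_rat q" "of_rat q < s" using of_rat_dense by blast
  have "0 \<le> t / of_rat p" using assms p0 by simp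
  then have q0: "0 < real_of_rat q" using q(1) by linarith
  show ?thesis
    using p q p0 q0 by (intro exI[of _ p] exI[of _ q]) (simp add: field_simps)
qed

lemma real_part_nonneg: "0 \<le> k \<Longrightarrow> k < of_rat c \<Longrightarrow> 0 \<le> real_part k"
  for k :: "'k::linordered_field"
  using real_part_lower[of k c 0] by simp

text \<open>If the two sides differed, rational approximations of the factors would have their
  product strictly between them, and multiplying the corresponding inequalities for \<open>k\<close>
  and \<open>l\<close> would put \<open>k * l\<close> on the wrong side of that rational. The
  rational bounds keep all cuts bounded.\<close>

lemma real_part_mult:
  fixes k l :: "'k::linordered_field"
  assumes k: "0 \<le> k" "k < of_rat c" and l: "0 \<le> l" "l < of_rat d"
  shows "real_part (k * l) = real_part k * real_part l"
proof -
  have bk: "\<bar>k\<bar> < of_rat c" and bl: "\<bar>l\<bar> < of_rat d" using k l by auto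
  have bkl: "\<bar>k * l\<bar> < of_rat (c * d)"
    using mult_strict_mono'[OF k(2) l(2) k(1) l(1)] k l by (simp add: of_rat_mult abs_mult)
  have nn: "0 \<le> real_part k" "0 \<le> real_part l" "0 \<le> real_part (k * l)"
    using real_part_nonneg[OF k] real_part_nonneg[OF l] bkl k l
    by (auto intro: real_part_nonneg[of _ "c * d"])
  show ?thesis
  proof (rule antisym; rule ccontr)
    assume "\<not> real_part (k * l) \<le> real_part k * real_part l"
    then obtain p q where pq: "real_part k < of_rat p" "real_part l < of_rat q"
      "of_rat p * of_rat q < real_part (k * l)"
      using rat_factors_above[OF nn(1,2), of "real_part (k * l)"] by auto
    have "0 \<le> p" using le_less_trans[OF nn(1) pq(1)] by simp
    have "k \<le> of_rat p" using real_part_lower[OF bk, of p] pq by linarith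
    moreover have "l \<le> of_rat q" using real_part_lower[OF bl, of q] pq by linarith
    ultimately have "k * l \<le> of_rat (p * q)"
      unfolding of_rat_mult using k l \<open>0 \<le> p\<close> by (intro mult_mono) auto
    from real_part_upper[OF bkl this] show False using pq by (simp add: of_rat_mult)
  next
    assume "\<not> real_part k * real_part l \<le> real_part (k * l)"
    then obtain p q :: rat where pq: "0 < p" "0 < q" "of_rat p < real_part k" "of_rat q < real_part l"
      "real_part (k * l) < of_rat p * of_rat q"
      using rat_factors_below[OF nn] by auto
    have "of_rat p \<le> k" using real_part_upper[OF bk, of p] pq by linarith
    moreover have "of_rat q \<le> l" using real_part_upper[OF bl, of q] pq by linarith
    ultimately have "of_rat (p * q) \<le> k * l"
      unfolding of_rat_mult using pq k l by (intro mult_mono) auto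
    from real_part_lower[OF bkl this] show False using pq by (simp add: of_rat_mult)
  qed
qed

subsection \<open>The Dirichlet problem over an ordered field\<close>

text \<open>Replaces list paths with a condition on each edge by a closure, so that rule induction
  applies.\<close>

lemma walk_iff_rtranclp:
  "(\<exists>xs. walk b x xs y \<and> (\<forall>i. Suc i < length xs \<longrightarrow> P (xs ! i) (xs ! Suc i))) \<longleftrightarrow>
    (\<lambda>p q. adj b p q \<and> P p q)\<^sup>*\<^sup>* x y" (is "?L \<longleftrightarrow> ?R\<^sup>*\<^sup>* x y")
proof
  assume ?L
  then obtain xs where xs: "walk b x xs y" "\<And>i. Suc i < length xs \<Longrightarrow> P (xs ! i) (xs ! Suc i)"
    by blast
  have "?R\<^sup>*\<^sup>* (xs ! 0) (xs ! i)" if "i < length xs" for i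
    using that
  proof (induction i)
    case (Suc i)
    then have "?R (xs ! i) (xs ! Suc i)" using xs by (simp add: walk_def)
    with Suc show ?case by (simp add: rtranclp.rtrancl_into_rtrancl)
  qed simp
  from this[of "length xs - 1"] show "?R\<^sup>*\<^sup>* x y"
    using xs(1) by (auto simp: walk_def hd_conv_nth last_conv_nth)
next
  assume "?R\<^sup>*\<^sup>* x y"
  then show ?L
  proof (induction rule: converse_rtranclp_induct)
    case base
    show ?case by (intro exI[of _ "[y]"]) (simp add: walk_def)
  next
    case (step x z)
    then obtain xs where xs: "walk b z xs y" "\<And>i. Suc i < length xs \<Longrightarrow> P (xs ! i) (xs ! Suc i)"
      by blast
    have "xs \<noteq> []" "xs ! 0 = z" using xs(1) by (auto simp: walk_def hd_conv_nth)
    then have e: "adj b ((x # xs) ! i) (xs ! i) \<and> P ((x # xs) ! i) (xs ! i)" if "i < length xs" for i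
      using xs step.hyps(1) that by (cases i) (auto simp: walk_def)
    show ?case
      using e xs(1) by (intro exI[of _ "x # xs"]) (auto simp: walk_def)
  qed
qed

text \<open>\<open>deg_pos\<close> excludes the one-vertex graph; an essential component guarantees
  it, see \<open>essential_component_deg_pos\<close>.\<close>

locale network =
  fixes b :: "'v \<Rightarrow> 'v \<Rightarrow> 'k::linordered_field"
  assumes weighted: "weighted_graph b" and connected: "connected_on b UNIV"
    and locally_finite: "locally_finite b" and deg_pos: "0 < deg b x"
begin

lemma b_nonneg: "0 \<le> b x y" using weighted by (simp add: weighted_graph_def)

lemma b_sym: "b x y = b y x" using weighted by (simp add: weighted_graph_def)

lemma finite_nbrs: "finite (nbrs b x)" using locally_finite by (simp add: locally_finite_def)

lemma b_eq_0: "y \<notin> nbrs b x \<Longrightarrow> b x y = 0"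
  using b_nonneg[of x y] by (simp add: nbrs_def adj_def)

lemma b_le_deg: "b x y \<le> deg b x"
proof (cases "y \<in> nbrs b x")
  case True
  then show ?thesis unfolding deg_def using finite_nbrs b_nonneg by (intro member_le_sum) auto
qed (use b_eq_0 deg_pos[of x] in auto)

lemma adj_connected: "(adj b)\<^sup>*\<^sup>* x y"
  using connected walk_iff_rtranclp[of b x y "\<lambda>_ _. True"] by (auto simp: connected_on_def)

lemma laplacian_eq: "laplacian b f x = f x - (\<Sum>y\<in>nbrs b x. b x y / deg b x * f y)"
proof -
  have "laplacian b f x = (\<Sum>y\<in>nbrs b x. b x y) / deg b x * f x - (\<Sum>y\<in>nbrs b x. b x y * f y) / deg b x"
    by (simp add: laplacian_def right_diff_distrib sum_subtractf sum_distrib_right diff_divide_distrib)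
  then show ?thesis using deg_pos[of x] by (simp add: deg_def sum_divide_distrib)
qed

lemma laplacian_add_mult:
  "laplacian b (\<lambda>x. f x + t * g x) x = laplacian b f x + t * laplacian b g x"
  by (simp add: laplacian_eq algebra_simps sum.distrib sum_distrib_left add_divide_distrib)

lemma laplacian_const: "laplacian b (\<lambda>_. c) x = 0"
  by (simp add: laplacian_def)

text \<open>A positive maximum sits in the finite set \<open>F\<close>, where subharmonicity forces
  all neighbours to share it. Connectedness carries the value to a vertex outside \<open>F\<close>,
  where it cannot be positive.\<close>

lemma maximum_principle:
  assumes F: "finite F" "F \<noteq> UNIV"
    and sub: "\<And>x. x \<in> F \<Longrightarrow> laplacian b f x \<le> 0"
    and out: "\<And>x. x \<notin> F \<Longrightarrow> f x \<le> 0"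
  shows "f x \<le> 0"
proof (rule ccontr)
  assume "\<not> f x \<le> 0"
  then have x: "0 < f x" "x \<in> F" using out by force+
  define m where "m = Max (f ` F)"
  have "m \<in> f ` F" unfolding m_def using F x by (intro Max_in) auto
  then obtain x0 where x0: "x0 \<in> F" "f x0 = m" by blast
  have "f x \<le> m" unfolding m_def using F x by (intro Max_ge) auto
  then have m: "0 < m" using x by linarith
  have le: "f y \<le> m" for y
    using F out[of y] m by (cases "y \<in> F") (auto simp: m_def)
  have "f z = m" if "(adj b)\<^sup>*\<^sup>* x0 z" for z
    using that
  proof induction
    case (step p q)
    then have "p \<in> F" using out[of p] m by force
    then have "(\<Sum>y\<in>nbrs b p. b p y * (m - f y)) \<le> 0"
      using sub[of p] deg_pos[of p] step.IH
      by (simp add: laplacian_def divide_le_0_iff)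
    moreover have "\<forall>y\<in>nbrs b p. 0 \<le> b p y * (m - f y)" using b_nonneg le by simp
    ultimately have "(\<Sum>y\<in>nbrs b p. b p y * (m - f y)) = 0" by (simp add: sum_nonneg antisym)
    then have "b p q * (m - f q) = 0"
      using \<open>\<forall>y\<in>nbrs b p. _\<close> step.hyps(2) finite_nbrs
      by (subst (asm) sum_nonneg_eq_0_iff) (auto simp: nbrs_def)
    then show ?case using step.hyps(2) by (simp add: adj_def)
  qed (rule x0)
  moreover obtain z where "z \<notin> F" using F by blast
  ultimately show False using out[of z] adj_connected[of x0 z] m by force
qed

text \<open>Adding a point \<open>z\<close> to \<open>F\<close>: correct the solution vanishing at \<open>z\<close> by a multiple of the one that
  is 1 at \<open>z\<close>, whose Laplacian at \<open>z\<close> cannot vanish by the maximum principle.\<close>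

lemma dirichlet_solution:
  assumes "finite F" "F \<noteq> UNIV"
  shows "\<exists>f. (\<forall>x\<in>F. laplacian b f x = 0) \<and> (\<forall>x. x \<notin> F \<longrightarrow> f x = g x)"
  using assms
proof (induction F arbitrary: g rule: finite_induct)
  case empty
  show ?case by auto
next
  case (insert z F)
  then have F: "F \<noteq> UNIV" by auto
  obtain f0 where f0: "\<And>x. x \<in> F \<Longrightarrow> laplacian b f0 x = 0"
    "\<And>x. x \<notin> F \<Longrightarrow> f0 x = (g(z := 0)) x"
    using insert.IH[OF F] by blast
  obtain f1 where f1: "\<And>x. x \<in> F \<Longrightarrow> laplacian b f1 x = 0"
    "\<And>x. x \<notin> F \<Longrightarrow> f1 x = ((\<lambda>_. 0)(z := 1)) x"
    using insert.IH[OF F] by blast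
  have nz: "laplacian b f1 z \<noteq> 0"
  proof
    assume "laplacian b f1 z = 0"
    then have "f1 z \<le> 0"
      using f1 insert.prems insert.hyps(1) by - (rule maximum_principle[of "insert z F"], auto)
    then show False using f1(2)[OF insert.hyps(2)] by simp
  qed
  define t where "t = - laplacian b f0 z / laplacian b f1 z"
  have "laplacian b (\<lambda>x. f0 x + t * f1 x) x = 0" if "x \<in> insert z F" for x
    unfolding laplacian_add_mult using that f0 f1 nz by (auto simp: t_def)
  moreover have "f0 x + t * f1 x = g x" if "x \<notin> insert z F" for x
    using that f0 f1 by auto
  ultimately show ?case by (intro exI[of _ "\<lambda>x. f0 x + t * f1 x"]) blast
qed

lemma dirichlet_unique:
  assumes F: "finite F" "F \<noteq> UNIV"
    and f: "\<And>x. x \<in> F \<Longrightarrow> laplacian b f x = 0" and g: "\<And>x. x \<in> F \<Longrightarrow> laplacian b g x = 0"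
    and eq: "\<And>x. x \<notin> F \<Longrightarrow> f x = g x"
  shows "f = g"
proof
  fix x
  \<comment> \<open>The difference is written in the form that \<open>laplacian_add_mult\<close>
    matches.\<close>
  have "f x + (-1) * g x \<le> 0"
    by (rule maximum_principle[OF F]) (simp_all only: laplacian_add_mult f g, simp_all add: eq)
  moreover have "g x + (-1) * f x \<le> 0"
    by (rule maximum_principle[OF F]) (simp_all only: laplacian_add_mult f g, simp_all add: eq)
  ultimately show "f x = g x" by simp
qed

context
  fixes F :: "'v set" and a :: 'v
  assumes F: "finite F" and a: "a \<in> F"
begin

lemma equilibrium_spec:
  "(\<forall>x\<in>F - {a}. laplacian b (equilibrium b F a) x = 0) \<and> equilibrium b F a a = 1 \<and>
    (\<forall>x. x \<notin> F \<longrightarrow> equilibrium b F a x = 0)"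
proof -
  \<comment> \<open>Removing \<open>a\<close> leaves a boundary vertex even when the graph is finite
    and \<open>F\<close> is all of it.\<close>
  have F': "finite (F - {a})" "F - {a} \<noteq> UNIV" using F by auto
  obtain f where f: "\<forall>x\<in>F - {a}. laplacian b f x = 0" "\<forall>x. x \<notin> F - {a} \<longrightarrow> f x = (if x = a then 1 else 0)"
    using dirichlet_solution[OF F', of "\<lambda>x. if x = a then 1 else 0"] by blast
  have "\<exists>!v. (\<forall>x\<in>F - {a}. laplacian b v x = 0) \<and> v a = 1 \<and> (\<forall>x. x \<notin> F \<longrightarrow> v x = 0)"
  proof (rule ex1I[of _ f])
    show "(\<forall>x\<in>F - {a}. laplacian b f x = 0) \<and> f a = 1 \<and> (\<forall>x. x \<notin> F \<longrightarrow> f x = 0)"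
      using f a by auto
  next
    fix v assume "(\<forall>x\<in>F - {a}. laplacian b v x = 0) \<and> v a = 1 \<and> (\<forall>x. x \<notin> F \<longrightarrow> v x = 0)"
    then show "v = f" using f by (intro dirichlet_unique[OF F']) auto
  qed
  from theI'[OF this] show ?thesis unfolding equilibrium_def .
qed

lemma equilibrium_harmonic:
  "x \<in> F \<Longrightarrow> x \<noteq> a \<Longrightarrow> equilibrium b F a x = (\<Sum>y\<in>nbrs b x. b x y / deg b x * equilibrium b F a y)"
  using equilibrium_spec laplacian_eq[of "equilibrium b F a" x] by simp

lemma equilibrium_self: "equilibrium b F a a = 1" using equilibrium_spec by simp

lemma equilibrium_outside: "x \<notin> F \<Longrightarrow> equilibrium b F a x = 0" using equilibrium_spec by simp

lemma equilibrium_le_1: "equilibrium b F a x \<le> 1"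
proof -
  have "equilibrium b F a x + (-1) * 1 \<le> 0"
  proof (rule maximum_principle[of "F - {a}"])
    show "laplacian b (\<lambda>x. equilibrium b F a x + (-1) * 1) y \<le> 0" if "y \<in> F - {a}" for y
      unfolding laplacian_add_mult laplacian_const using equilibrium_spec that by simp
    show "equilibrium b F a y + (-1) * 1 \<le> 0" if "y \<notin> F - {a}" for y
      using equilibrium_spec that by (cases "y = a") auto
  qed (use F in auto)
  then show ?thesis by simp
qed

lemma equilibrium_nonneg: "0 \<le> equilibrium b F a x"
proof -
  have "0 + (-1) * equilibrium b F a x \<le> 0"
  proof (rule maximum_principle[of "F - {a}"])
    show "laplacian b (\<lambda>x. 0 + (-1) * equilibrium b F a x) y \<le> 0" if "y \<in> F - {a}" for y
      unfolding laplacian_add_mult laplacian_const using equilibrium_spec that by simp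
    show "0 + (-1) * equilibrium b F a y \<le> 0" if "y \<notin> F - {a}" for y
      using equilibrium_spec that by (cases "y = a") auto
  qed (use F in auto)
  then show ?thesis by simp
qed

text \<open>The normalized capacity as an escape probability; its real part will be compared with
  one minus the return probability.\<close>

lemma cap_div_deg:
  "cap b F a / deg b a = 1 - (\<Sum>y\<in>nbrs b a. b a y / deg b a * equilibrium b F a y)"
  using deg_pos[of a] laplacian_eq[of "equilibrium b F a" a] by (simp add: cap_def equilibrium_self)

end

lemma b_div_deg: "0 \<le> b x y / deg b x" "b x y / deg b x \<le> 1"
  using b_nonneg[of x y] b_le_deg[of x y] deg_pos[of x] by simp_all

lemma real_part_average:
  assumes f: "\<And>y. 0 \<le> f y" "\<And>y. f y \<le> 1"
  shows "real_part (\<Sum>y\<in>nbrs b x. b x y / deg b x * f y) =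
    (\<Sum>y\<in>nbrs b x. real_transition b x y * real_part (f y))"
proof -
  \<comment> \<open>The constant 2 is just a strict rational bound for elements of the unit
    interval.\<close>
  have one: "(1 :: 'k) < of_rat 2" by simp
  have lt2: "b x y / deg b x < of_rat 2" "f y < of_rat 2" for y
    using le_less_trans[OF b_div_deg(2)[of x y] one] le_less_trans[OF f(2)[of y] one] .
  have "\<bar>b x y / deg b x * f y\<bar> < of_rat 2" for y
    using le_less_trans[OF mult_le_one[OF b_div_deg(2)[of x y] f(1)[of y] f(2)[of y]] one]
      mult_nonneg_nonneg[OF b_div_deg(1)[of x y] f(1)[of y]] by (simp only: abs_of_nonneg)
  then have "real_part (\<Sum>y\<in>nbrs b x. b x y / deg b x * f y) =
      (\<Sum>y\<in>nbrs b x. real_part (b x y / deg b x * f y))"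
    using real_part_sum[OF finite_nbrs, of x "\<lambda>y. b x y / deg b x * f y"] by blast
  also have "\<dots> = (\<Sum>y\<in>nbrs b x. real_transition b x y * real_part (f y))"
    unfolding real_transition_def
    by (intro sum.cong refl real_part_mult[OF b_div_deg(1) lt2(1) f(1) lt2(2)])
  finally show ?thesis .
qed

end

text \<open>The delicate case is \<open>l = 0\<close>: nonnegativity makes the quotients tend to
  \<open>\<infinity>\<close>, and terms with \<open>c n = 0\<close> already have that value.\<close>

lemma ereal_inverse_tendsto:
  fixes c :: "nat \<Rightarrow> real"
  assumes lim: "c \<longlonglongrightarrow> l" and nn: "\<And>n. 0 \<le> c n"
  shows "(\<lambda>n. 1 / ereal (c n)) \<longlonglongrightarrow> 1 / ereal l"
proof (cases "l = 0")
  case False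
  have "(\<lambda>n. ereal (1 / c n)) \<longlonglongrightarrow> ereal (1 / l)"
    using lim False by (intro tendsto_intros)
  moreover have "\<forall>\<^sub>F n in sequentially. c n \<noteq> 0" using tendsto_imp_eventually_ne[OF lim False] .
  ultimately show ?thesis
    using False by (subst tendsto_cong[of _ "\<lambda>n. ereal (1 / c n)"])
      (auto simp: one_ereal_def elim!: eventually_mono)
next
  case True
  have "(\<lambda>n. 1 / ereal (c n)) \<longlonglongrightarrow> \<infinity>"
    unfolding tendsto_PInfty
  proof
    fix r :: real
    \<comment> \<open>\<open>\<bar>r\<bar> + 1\<close> is positive and exceeds \<open>r\<close>
      whatever the sign of \<open>r\<close>.\<close>
    have "\<forall>\<^sub>F n in sequentially. c n < 1 / (\<bar>r\<bar> + 1)"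
      using lim True by (intro order_tendstoD) (auto simp: field_simps)
    then show "\<forall>\<^sub>F n in sequentially. ereal r < 1 / ereal (c n)"
    proof eventually_elim
      case (elim n)
      show ?case
      proof (cases "c n = 0")
        case False
        then have "0 < c n" using nn[of n] by simp
        then have "\<bar>r\<bar> + 1 < 1 / c n" using elim by (simp add: field_simps)
        then have "r < 1 / c n" by linarith
        then show ?thesis using False by (simp add: one_ereal_def)
      qed (simp add: divide_ereal_def flip: zero_ereal_def)
    qed
  qed
  then show ?thesis using True by (simp add: divide_ereal_def flip: zero_ereal_def)
qed

section \<open>Comparability of positive elements is symmetric and transitive\<close>

lemma similar_refl: "0 < k \<Longrightarrow> similar k k"
  unfolding similar_def
  by (intro conjI exI[of _ "1/2"] exI[of _ 2]) (simp_all add: of_rat_divide)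

lemma similar_sym: "similar k l \<Longrightarrow> similar l k"
proof -
  assume "similar k l"
  then obtain c d :: rat where *: "0 < k" "0 < l" "0 < c" "0 < d" "of_rat c < k / l" "k / l < of_rat d"
    by (auto simp: similar_def)
  then show "similar l k" unfolding similar_def
    by (intro conjI exI[of _ "1/d"] exI[of _ "1/c"]) (simp_all add: of_rat_divide field_simps)
qed

lemma similar_trans: "similar k l \<Longrightarrow> similar l m \<Longrightarrow> similar k m"
proof -
  assume "similar k l" "similar l m"
  then obtain c d c' d' :: rat where *: "0 < k" "0 < l" "0 < m" "0 < c" "0 < d" "0 < c'" "0 < d'"
    "of_rat c < k / l" "k / l < of_rat d" "of_rat c' < l / m" "l / m < of_rat d'"
    by (auto simp: similar_def)
  have "of_rat c * of_rat c' < k / l * (l / m)"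
    using * by (intro mult_strict_mono) simp_all
  moreover have "k / l * (l / m) < of_rat d * of_rat d'"
    using * by (intro mult_strict_mono) simp_all
  ultimately show "similar k m" unfolding similar_def using *
    by (intro conjI exI[of _ "c * c'"] exI[of _ "d * d'"]) (simp_all add: of_rat_mult)
qed

lemma similar_pos: "similar k l \<Longrightarrow> 0 < k" "similar k l \<Longrightarrow> 0 < l"
  by (simp_all add: similar_def)

subsection \<open>Essential components\<close>

context network
begin

text \<open>The edges are compared with one degree only, and the two degrees with each other, so
  transitivity of \<open>similar\<close> and reversal of paths apply. Adjacency is implicit, since
  \<open>similar\<close> forces positive weights.\<close>

definition linked :: "'v \<Rightarrow> 'v \<Rightarrow> bool" where
  "linked x y \<longleftrightarrow> similar (deg b x) (deg b y) \<and> (\<lambda>p q. similar (deg b x) (b p q))\<^sup>*\<^sup>* x y"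

lemma strongly_linked_iff: "strongly_linked b C \<longleftrightarrow> (\<forall>x\<in>C. \<forall>y\<in>C. linked x y)"
proof -
  have "(\<exists>xs. walk b x xs y \<and> (\<forall>i. Suc i < length xs \<longrightarrow>
      similar (deg b x) (b (xs ! i) (xs ! Suc i)) \<and> similar (b (xs ! i) (xs ! Suc i)) (deg b y)))
    \<longleftrightarrow> linked x y" for x y
  proof -
    let ?R = "\<lambda>p q. adj b p q \<and> similar (deg b x) (b p q) \<and> similar (b p q) (deg b y)"
    have "?R\<^sup>*\<^sup>* x y \<longleftrightarrow> linked x y"
    proof
      assume R: "?R\<^sup>*\<^sup>* x y"
      \<comment> \<open>On a path of length zero this is reflexivity, which rests on
        \<open>deg_pos\<close>; otherwise the last edge links both degrees.\<close>
      then have "similar (deg b x) (deg b y)"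
        by (cases rule: rtranclp.cases) (auto intro: similar_refl deg_pos similar_trans)
      moreover have "(\<lambda>p q. similar (deg b x) (b p q))\<^sup>*\<^sup>* x y"
        using R by (rule mono_rtranclp[rule_format, rotated]) simp
      ultimately show "linked x y" by (simp add: linked_def)
    next
      assume L: "linked x y"
      have "(\<lambda>p q. similar (deg b x) (b p q))\<^sup>*\<^sup>* x y" using L by (simp add: linked_def)
      then show "?R\<^sup>*\<^sup>* x y"
      proof (rule mono_rtranclp[rule_format, rotated])
        fix p q assume "similar (deg b x) (b p q)"
        then show "?R p q"
          using L similar_pos(2) similar_sym similar_trans unfolding linked_def adj_def by blast
      qed
    qed
    then show ?thesis
      using walk_iff_rtranclp[of b x y "\<lambda>p q. similar (deg b x) (b p q) \<and> similar (b p q) (deg b y)"]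
      by simp
  qed
  then show ?thesis by (simp add: strongly_linked_def)
qed

lemma linked_path_mono:
  assumes "similar d e" and "(\<lambda>p q. similar e (b p q))\<^sup>*\<^sup>* x y"
  shows "(\<lambda>p q. similar d (b p q))\<^sup>*\<^sup>* x y"
  using assms(2)
  by (rule mono_rtranclp[rule_format, rotated]) (rule similar_trans[OF assms(1)])

lemma linked_sym: "linked x y \<Longrightarrow> linked y x"
proof -
  assume L: "linked x y"
  then have "(\<lambda>p q. similar (deg b y) (b p q))\<^sup>*\<^sup>* x y"
    using linked_path_mono[of "deg b y" "deg b x" x y] by (auto simp: linked_def intro: similar_sym)
  then have "(\<lambda>p q. similar (deg b y) (b p q))\<inverse>\<inverse>\<^sup>*\<^sup>* y x"
    by (simp add: rtranclp_conversep)
  moreover have "(\<lambda>p q. similar (deg b y) (b p q))\<inverse>\<inverse> = (\<lambda>p q. similar (deg b y) (b p q))"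
    by (intro ext) (simp add: b_sym)
  ultimately show "linked y x" using L by (simp add: linked_def similar_sym)
qed

lemma linked_trans: "linked x y \<Longrightarrow> linked y z \<Longrightarrow> linked x z"
  unfolding linked_def using linked_path_mono similar_trans by (meson rtranclp_trans)

lemma linked_edge: "similar (b x y) (deg b x) \<Longrightarrow> similar (deg b x) (deg b y) \<Longrightarrow> linked x y"
  by (auto simp: linked_def intro: similar_sym)

context
  fixes C :: "'v set"
  assumes C: "essential_component b C"
begin

lemma component_linked: "x \<in> C \<Longrightarrow> y \<in> C \<Longrightarrow> linked x y"
  using C strongly_linked_iff[of C] by (auto simp: essential_component_def strong_component_def)

text \<open>Essentiality for the one-edge path makes the two degrees comparable, so \<open>y\<close>
  is linked to \<open>x\<close> and maximality absorbs it into \<open>C\<close>.\<close>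

lemma component_closed:
  assumes x: "x \<in> C" and edge: "similar (b x y) (deg b x)"
  shows "y \<in> C"
proof -
  have "walk b x [x, y] y" using similar_pos(1)[OF edge] by (simp add: walk_def adj_def)
  moreover have "\<forall>i. Suc i < length [x, y] \<longrightarrow> similar (b ([x, y] ! i) ([x, y] ! Suc i)) (deg b ([x, y] ! i))"
    using edge by simp
  ultimately have "similar (deg b x) (deg b y)" using C x unfolding essential_component_def by blast
  then have xy: "linked x y" using edge by (intro linked_edge)
  \<comment> \<open>The vertex \<open>x\<close> serves as a hub: any two vertices of the enlarged
    set are linked through it.\<close>
  have "linked x u" if "u \<in> insert y C" for u
    using that component_linked[OF x] xy by blast
  then have "linked u w" if "u \<in> insert y C" "w \<in> insert y C" for u w
    using that linked_trans[OF linked_sym] by blast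
  then have "strongly_linked b (insert y C)" by (simp add: strongly_linked_iff)
  then show ?thesis using C unfolding essential_component_def strong_component_def by blast
qed

end

end

section \<open>The real chain on an essential component\<close>

locale network_kernel = network b for b :: "'v::countable \<Rightarrow> 'v \<Rightarrow> 'k::linordered_field" +
  fixes K :: "'v \<Rightarrow> 'v pmf"
  assumes transition: "real_transition b x y = pmf (K x) y"
begin

lemma set_pmf_subset_nbrs: "set_pmf (K x) \<subseteq> nbrs b x"
proof
  fix y assume "y \<in> set_pmf (K x)"
  then have "real_transition b x y \<noteq> 0" by (simp add: transition set_pmf_iff)
  then have "b x y \<noteq> 0" by (auto simp: real_transition_def)
  then show "y \<in> nbrs b x" using b_eq_0 by blast
qed

sublocale finite_kernel K
  by unfold_locales (rule finite_subset[OF set_pmf_subset_nbrs finite_nbrs])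

lemma avg_eq_nbrs: "avg f x = (\<Sum>y\<in>nbrs b x. real_transition b x y * f y)"
  unfolding avg_def transition
  by (rule sum.mono_neutral_left[OF finite_nbrs set_pmf_subset_nbrs]) (simp add: set_pmf_iff)

text \<open>A positive real part means that the ratio exceeds a positive rational; the upper
  rational bound is automatic because the ratio is at most 1.\<close>

lemma set_pmf_iff_similar: "y \<in> set_pmf (K x) \<longleftrightarrow> similar (b x y) (deg b x)"
proof -
  let ?p = "b x y / deg b x"
  have bd: "?p < of_rat 2" using le_less_trans[OF b_div_deg(2)[of x y], of "of_rat 2"] by simp
  then have bd': "\<bar>?p\<bar> < of_rat 2" using b_div_deg(1)[of x y] by simp
  show ?thesis
  proof
    assume y: "y \<in> set_pmf (K x)"
    then have "0 < real_part ?p"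
      using transition[of x y] pmf_positive[OF y] by (simp add: real_transition_def)
    then obtain q where q: "0 < real_of_rat q" "of_rat q < real_part ?p"
      using of_rat_dense by blast
    have "of_rat q < ?p" using real_part_upper[OF bd', of q] q by force
    moreover have "0 < b x y" using y set_pmf_subset_nbrs by (auto simp: nbrs_def adj_def)
    ultimately show "similar (b x y) (deg b x)"
      unfolding similar_def using bd q deg_pos by (intro conjI exI[of _ q] exI[of _ 2]) simp_all
  next
    assume "similar (b x y) (deg b x)"
    then obtain c :: rat where "0 < c" "of_rat c < ?p" by (auto simp: similar_def)
    then have "0 < real_part ?p" using real_part_lower[OF bd', of c] by (simp add: less_le_trans[OF _ real_part_lower[OF bd', of c]])
    then show "y \<in> set_pmf (K x)" by (simp add: set_pmf_iff flip: transition) (simp add: real_transition_def)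
  qed
qed

text \<open>The edges of a linking path are comparable to \<open>deg b x\<close>. Membership in
  \<open>C\<close>, carried along the path, makes them comparable to the degree at their own start,
  so they survive in the real chain.\<close>

lemma component_reaches:
  assumes C: "essential_component b C" and x: "x \<in> C" and y: "y \<in> C"
  shows "reaches x y"
proof -
  have "(\<lambda>p q. similar (deg b x) (b p q))\<^sup>*\<^sup>* x y"
    using component_linked[OF C x y] by (simp add: linked_def)
  then have "y \<in> C \<and> reaches x y"
  proof induction
    case (step p q)
    then have "similar (deg b x) (deg b p)" using component_linked[OF C x, of p] by (simp add: linked_def)
    then have "similar (b p q) (deg b p)" using step.hyps(2) by (meson similar_sym similar_trans)
    then show ?case using step.IH component_closed[OF C, of p q] set_pmf_iff_similar
      by (auto intro: rtranclp.rtrancl_into_rtrancl)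
  qed (simp add: x)
  then show ?thesis ..
qed

lemma component_closed_reaches:
  assumes C: "essential_component b C" and "reaches x y" and x: "x \<in> C"
  shows "y \<in> C"
  using assms(2)
  by induction (auto simp: x set_pmf_iff_similar intro: component_closed[OF C])

subsection \<open>Real parts of equilibrium potentials\<close>

definition potential :: "'v set \<Rightarrow> 'v \<Rightarrow> 'v \<Rightarrow> real" where
  "potential F a x = real_part (equilibrium b F a x)"

context
  fixes F :: "'v set" and a :: 'v
  assumes F: "finite F" and a: "a \<in> F"
begin

lemma equilibrium_bounds: "0 \<le> equilibrium b F a x" "equilibrium b F a x \<le> 1"
  by (rule equilibrium_nonneg[OF F a], rule equilibrium_le_1[OF F a])

lemma equilibrium_lt_2: "\<bar>equilibrium b F a x\<bar> < of_rat 2"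
  using le_less_trans[OF equilibrium_bounds(2)[of x], of "of_rat 2"] equilibrium_bounds(1)[of x] by simp

lemma potential_nonneg: "0 \<le> potential F a x"
  using real_part_lower[OF equilibrium_lt_2, of 0] equilibrium_bounds(1)[of x]
  by (simp add: potential_def)

lemma potential_self: "potential F a a = 1"
  by (simp add: potential_def equilibrium_self[OF F a])

lemma potential_outside: "x \<notin> F \<Longrightarrow> potential F a x = 0"
  by (simp add: potential_def equilibrium_outside[OF F a])

lemma real_part_average_equilibrium:
  "real_part (\<Sum>y\<in>nbrs b x. b x y / deg b x * equilibrium b F a y) = avg (potential F a) x"
  unfolding avg_eq_nbrs potential_def by (rule real_part_average[OF equilibrium_bounds])

lemma potential_harmonic: "x \<in> F \<Longrightarrow> x \<noteq> a \<Longrightarrow> potential F a x = avg (potential F a) x"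
  unfolding real_part_average_equilibrium[symmetric] potential_def
  by (subst equilibrium_harmonic[OF F a]) simp_all

lemma real_part_cap: "real_part (cap b F a / deg b a) = 1 - avg (potential F a) a"
proof -
  define s where "s = (\<Sum>y\<in>nbrs b a. b a y / deg b a * equilibrium b F a y)"
  have "0 \<le> s" unfolding s_def
    by (intro sum_nonneg mult_nonneg_nonneg b_div_deg equilibrium_bounds)
  moreover have "s \<le> (\<Sum>y\<in>nbrs b a. b a y / deg b a)" unfolding s_def
    by (intro sum_mono mult_left_le b_div_deg equilibrium_bounds)
  moreover have "(\<Sum>y\<in>nbrs b a. b a y / deg b a) = 1"
    using deg_pos[of a] by (simp add: deg_def flip: sum_divide_distrib)
  ultimately have s: "0 \<le> s" "s \<le> 1" by simp_all
  have one: "(1 :: 'k) < of_rat 2" by simp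
  have "\<bar>s\<bar> < of_rat 2" "\<bar>1 - s\<bar> < of_rat 2"
    using s le_less_trans[OF _ one, of s] le_less_trans[OF _ one, of "1 - s"] by simp_all
  \<comment> \<open>Additivity is applied to \<open>s + (1 - s) = 1\<close>.\<close>
  from real_part_add[OF this] have "real_part (1 - s) = 1 - real_part s" by simp
  then show ?thesis
    using real_part_average_equilibrium[of a]
    unfolding cap_div_deg[OF F a] s_def[symmetric] by simp
qed

text \<open>A positive maximum of \<open>potential F a - hit a\<close> over the vertices reachable from \<open>x\<close> would
  propagate along a path to \<open>a\<close>, where both functions are 1.\<close>

lemma potential_le_hit:
  assumes "reaches x a"
    and ret: "\<And>y. reaches x y \<Longrightarrow> reaches y a"
  shows "potential F a x \<le> hit a x"
proof (rule ccontr)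
  assume "\<not> potential F a x \<le> hit a x"
  then have pos: "0 < potential F a x - hit a x" by simp
  define w where "w y = potential F a y - hit a y" for y
  \<comment> \<open>Vertices of \<open>F\<close> that are not reachable from \<open>x\<close> may
    have no path to \<open>a\<close> in the real chain, so they are kept out of the maximum.\<close>
  define D where "D = {y \<in> F. reaches x y}"
  have out: "w y \<le> 0" if "y \<notin> F" for y using that by (simp add: w_def potential_outside hit_nonneg)
  have D: "finite D" "x \<in> D" using F out[of x] pos by (auto simp: D_def w_def)
  define m where "m = Max (w ` D)"
  have "m \<in> w ` D" unfolding m_def using D by (intro Max_in) auto
  then obtain x0 where x0: "x0 \<in> D" "w x0 = m" by blast
  have "w x \<le> m" unfolding m_def using D by (intro Max_ge) auto
  then have m: "0 < m" using pos by (simp add: w_def)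
  have le: "w y \<le> m" if "reaches x y" for y
  proof (cases "y \<in> F")
    case True
    then show ?thesis unfolding m_def using that D by (intro Max_ge) (auto simp: D_def)
  next
    case False
    then show ?thesis using out[of y] m by simp
  qed
  have "reaches x0 a" using x0 ret by (simp add: D_def)
  then have "reaches x a \<and> w a = m"
  proof induction
    case base
    show ?case using x0 by (simp add: D_def)
  next
    case (step p q)
    \<comment> \<open>Outside \<open>F\<close> and at \<open>a\<close> the difference is at most 0,
      so \<open>p\<close> is a vertex where both functions satisfy the mean value equation.\<close>
    then have "p \<in> F" "p \<noteq> a"
      using out[of p] m by (auto simp: w_def potential_self hit_self)
    then have "w p = avg w p"
      using avg_diff[of "potential F a" "hit a" p]
      by (simp add: w_def[abs_def] potential_harmonic hit_step)
    moreover have rq: "reaches x y" if "y \<in> set_pmf (K p)" for y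
      using step.IH that by (auto intro: rtranclp.rtrancl_into_rtrancl)
    ultimately show ?case
      using avg_eq_boundD[of p w m q] step le by simp
  qed
  then show False using m by (simp add: w_def potential_self hit_self)
qed

end

text \<open>Induction on the horizon by the first-step equation. The threshold for \<open>n\<close>
  depends on \<open>N\<close> and \<open>x\<close>, but each step combines only finitely many
  thresholds because the support is finite.\<close>

lemma eventually_hit_within_le_potential:
  assumes ex: "exhaustion b G" and a: "a \<in> G 0"
  shows "\<forall>\<^sub>F n in sequentially. hit_within a N x \<le> potential (G n) a x"
proof -
  have fin: "finite (G n)" and inc: "incseq G" and un: "(\<Union>n. G n) = UNIV" for n
    using ex by (auto simp: exhaustion_def)
  have an: "a \<in> G n" for n using a inc by (auto simp: incseq_def)
  show ?thesis
  proof (induction N arbitrary: x)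
    case 0
    show ?case
      by (cases "x = a") (simp_all add: potential_self[OF fin an] hit_within_le_1
          hit_within_0 potential_nonneg[OF fin an])
  next
    case (Suc N)
    show ?case
    proof (cases "x = a")
      case True
      then show ?thesis by (simp add: potential_self[OF fin an] hit_within_le_1)
    next
      case False
      obtain n0 where "x \<in> G n0" using un by blast
      then have "\<forall>\<^sub>F n in sequentially. x \<in> G n"
        using inc by (auto simp: eventually_sequentially incseq_def)
      moreover have "\<forall>\<^sub>F n in sequentially. \<forall>y\<in>set_pmf (K x). hit_within a N y \<le> potential (G n) a y"
        by (intro eventually_ball_finite finite_support ballI Suc.IH)
      ultimately show ?thesis
      proof eventually_elim
        case (elim n)
        then show ?case using False avg_mono[of x "hit_within a N" "potential (G n) a"]
          by (simp add: hit_within_Suc potential_harmonic[OF fin an])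
      qed
    qed
  qed
qed

lemma green_eq:
  assumes ex: "exhaustion b G" and a: "a \<in> G 0"
    and ret: "\<And>y. reaches a y \<Longrightarrow> reaches y a"
  shows "green b G a = 1 / ereal (1 - avg (hit a) a)"
proof -
  have fin: "finite (G n)" and inc: "incseq G" and un: "(\<Union>n. G n) = UNIV" for n
    using ex by (auto simp: exhaustion_def)
  have an: "a \<in> G n" for n using a inc by (auto simp: incseq_def)
  define p where "p n = avg (potential (G n) a) a" for n
  have le: "p n \<le> avg (hit a) a" for n
    unfolding p_def
  proof (rule avg_mono)
    fix y assume "y \<in> set_pmf (K a)"
    then have "reaches a y" by blast
    then show "potential (G n) a y \<le> hit a y"
      by (intro potential_le_hit[OF fin an] ret) (auto intro: rtranclp_trans)
  qed
  have "p \<longlonglongrightarrow> avg (hit a) a"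
  proof (rule order_tendstoI)
    fix r assume "r < avg (hit a) a"
    then have "\<forall>\<^sub>F N in sequentially. r < avg (hit_within a N) a"
      by (intro order_tendstoD(1)[OF avg_tendsto[OF hit_within_tendsto]])
    \<comment> \<open>The horizon is fixed before the exhaustion index grows, since the lower bound
      on potentials holds for one horizon at a time.\<close>
    then obtain N where N: "r < avg (hit_within a N) a" by (auto simp: eventually_sequentially)
    have "\<forall>\<^sub>F n in sequentially. \<forall>y\<in>set_pmf (K a). hit_within a N y \<le> potential (G n) a y"
      by (intro eventually_ball_finite finite_support ballI eventually_hit_within_le_potential[OF ex a])
    then show "\<forall>\<^sub>F n in sequentially. r < p n"
    proof eventually_elim
      case (elim n)
      then have "avg (hit_within a N) a \<le> p n" unfolding p_def by (intro avg_mono) blast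
      then show ?case using N by simp
    qed
  next
    fix r assume "avg (hit a) a < r"
    then show "\<forall>\<^sub>F n in sequentially. p n < r" 
      by (intro always_eventually allI) (rule le_less_trans[OF le])
  qed
  then have "(\<lambda>n. 1 - p n) \<longlonglongrightarrow> 1 - avg (hit a) a" by (intro tendsto_intros)
  moreover have "avg (hit a) a \<le> 1" using avg_hit_le[of a a] by (simp add: hit_self)
  then have "0 \<le> 1 - p n" for n using le[of n] by simp
  ultimately have "(\<lambda>n. 1 / ereal (1 - p n)) \<longlonglongrightarrow> 1 / ereal (1 - avg (hit a) a)"
    by (rule ereal_inverse_tendsto)
  then show ?thesis
    unfolding green_def green_on_def real_part_cap[OF fin an] p_def
    by (intro lim_imp_Limsup) simp_all
qed

lemma green_eq_infinity_iff:
  assumes "exhaustion b G" and "a \<in> G 0"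
    and "\<And>y. reaches a y \<Longrightarrow> reaches y a"
  shows "green b G a = \<infinity> \<longleftrightarrow> recurrent (real_transition b) a"
proof -
  have "real_transition b = (\<lambda>x y. pmf (K x) y)" by (intro ext transition)
  then show ?thesis
    using green_eq[OF assms] recurrent_iff_return[of a]
    by (cases "avg (hit a) a = 1")
      (simp_all add: divide_ereal_def flip: zero_ereal_def)
qed

end

text \<open>A singleton is strongly linked by its path of length zero, which has no edge to check,
  so the empty set is never maximal.\<close>

lemma essential_component_nonempty:
  assumes "essential_component b C"
  shows "C \<noteq> {}"
proof
  assume "C = {}"
  moreover have "strongly_linked b {x}" for x
    unfolding strongly_linked_def by (auto intro!: exI[of _ "[x]"] simp: walk_def)
  ultimately show False using assms
    by (auto simp: essential_component_def strong_component_def)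
qed

text \<open>For \<open>x\<close> in \<open>C\<close> the path of length zero yields comparability of
  \<open>deg b x\<close> with itself, which includes positivity. Every other vertex has a neighbour
  by connectedness.\<close>

lemma essential_component_deg_pos:
  assumes w: "weighted_graph b" and conn: "connected_on b UNIV" and lf: "locally_finite b"
    and C: "essential_component b C"
  shows "0 < deg b z"
proof -
  obtain x where x: "x \<in> C" using essential_component_nonempty[OF C] by blast
  have "walk b x [x] x" by (simp add: walk_def)
  then have "similar (deg b x) (deg b x)"
    using C x unfolding essential_component_def by fastforce
  then have px: "0 < deg b x" by (rule similar_pos)
  show ?thesis
  proof (cases "z = x")
    case False
    have "(adj b)\<^sup>*\<^sup>* z x"
      using conn walk_iff_rtranclp[of b z x "\<lambda>_ _. True"] by (auto simp: connected_on_def)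
    then obtain y where "adj b z y" using False by (auto elim: converse_rtranclpE)
    then have "0 < b z y" "y \<in> nbrs b z" by (simp_all add: adj_def nbrs_def)
    then show ?thesis
      unfolding deg_def using lf w
      by (intro sum_pos2[of _ y]) (auto simp: locally_finite_def weighted_graph_def)
  qed (simp add: px)
qed

theorem theorem5p4:
  fixes b :: "'v::countable \<Rightarrow> 'v \<Rightarrow> 'k::linordered_field"
    and C :: "'v set"
    and K :: "'v \<Rightarrow> nat \<Rightarrow> 'v set"
  assumes "weighted_graph b"
    and "connected_on b UNIV"
    and "locally_finite b"
    and "essential_component b C"
    and "\<And>a. a \<in> C \<Longrightarrow> exhaustion b (K a) \<and> a \<in> K a 0"
  shows "(recurrent_component (real_transition b) C \<longleftrightarrow> (\<exists>a\<in>C. green b (K a) a = \<infinity>)) \<and>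
         (recurrent_component (real_transition b) C \<longleftrightarrow> (\<forall>a\<in>C. green b (K a) a = \<infinity>)) \<and>
         (transient_component (real_transition b) C \<longleftrightarrow> (\<exists>a\<in>C. green b (K a) a < \<infinity>)) \<and>
         (transient_component (real_transition b) C \<longleftrightarrow> (\<forall>a\<in>C. green b (K a) a < \<infinity>))"
proof -
  have deg: "0 < deg b x" for x by (rule essential_component_deg_pos[OF assms(1-4)])
  obtain P where P: "\<And>x y. real_transition b x y = pmf (P x) y"
    using real_transition_pmf[OF assms(1,3) deg] by blast
  interpret network_kernel b P
    by unfold_locales (use assms deg P in auto)
  have green: "green b (K a) a = \<infinity> \<longleftrightarrow> recurrent (real_transition b) a" if "a \<in> C" for a
  proof (rule green_eq_infinity_iff)
    \<comment> \<open>Closedness keeps \<open>y\<close> in \<open>C\<close>, and within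
      \<open>C\<close> any two vertices reach each other.\<close>
    show "reaches y a" if "reaches a y" for y
      using component_reaches[OF assms(4)] component_closed_reaches[OF assms(4) that \<open>a \<in> C\<close>] \<open>a \<in> C\<close>
      by blast
  qed (use assms(5)[OF that] in auto)
  have transfer: "recurrent (real_transition b) c" if "recurrent (real_transition b) a" "a \<in> C" "c \<in> C" for a c
  proof -
    have "real_transition b = (\<lambda>x y. pmf (P x) y)" by (intro ext P)
    then show ?thesis
      using that(1) return_transfer[OF _ component_reaches[OF assms(4) that(2,3)]]
      by (simp add: recurrent_iff_return)
  qed
  \<comment> \<open>A vertex of \<open>C\<close> turns the universal claims into existential ones;
    \<open>transfer\<close> gives the converse.\<close>
  obtain z where "z \<in> C" using essential_component_nonempty[OF assms(4)] by blast
  then show ?thesis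
    unfolding recurrent_component_def transient_component_def transient_def
    using green transfer by (auto simp: less_top[symmetric] top_ereal_def)
qed

end
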